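(* Work in parametric cubical type theory. The weak law of excluded middle is refutable: there is an element of $\neg\mathsf{WLEM}$, where $$\mathsf{WLEM} := \Pi(A:\mathcal{U}).\ \Sigma(b:\mathsf{bool}).\ \mathsf{if}\ b\ \mathsf{then}\ \neg A\ \mathsf{else}\ \neg\neg A.$$
   Context: Parametric cubical type theory is cartesian cubical type theory (dependent $\Pi$ and $\Sigma$ types, booleans, the empty type $\bot$ and unit type $\top$, universe $\mathcal{U}$, path types over a structural path interval, Kan operations, univalence) extended with an affine bridge interval, bridge types $\mathrm{Bridge}_{\mathbf{x}.A}(M_0,M_1)$, the $\mathrm{extent}$ operator and $\mathrm{Gel}$-types $\mathrm{Gel}_{\mathbf{x}}(A_0,A_1,R)$ (a bridge of types from $A_0$ to $A_1$ built from any relation $R$). $\neg A := A \to \bot$; $\mathsf{if}\ b\ \mathsf{then}\ X\ \mathsf{else}\ Y$ is boolean case analysis into $\mathcal{U}$. *)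

theory Defs
  imports Main
begin

text \<open>
  A deep embedding of parametric cubical type theory: raw syntax with de Bruijn indices, and the
  derivability of the judgmental equalities as an inductive definition.

  Terms, types and interval terms form one raw syntactic category, and the variables of all sorts
  share one index space; the sorts are separated by the judgments. As usual both intervals have
  endpoints written \<open>0\<close> and \<open>1\<close>.
\<close>

datatype ival = PathI | BridgeI

text \<open>
  \<open>Tube k p q N\<close> is the tube \<open>p = q \<hookrightarrow> y. N\<close> of a composition, with \<open>p = q\<close> a constraint on the
  interval \<open>k\<close>; the body \<open>N\<close> binds the path variable \<open>y\<close>.
  Binding structure of the other constructors:
  \<^item> one variable in the last argument of \<open>Pi\<close>, \<open>Lam\<close>, \<open>Sig\<close>, \<open>PLam\<close>, \<open>BLam\<close>, \<open>Ungel\<close>, in the first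
    argument (motive or type line) of \<open>Cond\<close>, \<open>PathT\<close>, \<open>Bridge\<close>, and in the third argument (type
    line) of \<open>Coe\<close>;
  \<^item> \<open>Gel r A\<^sub>0 A\<^sub>1 R\<close> binds \<open>a\<^sub>0\<close> (index 1) and \<open>a\<^sub>1\<close> (index 0) in \<open>R\<close>;
  \<^item> \<open>Extent r M N\<^sub>0 N\<^sub>1 N\<close> binds one variable in each of \<open>N\<^sub>0\<close> and \<open>N\<^sub>1\<close>, and in \<open>N\<close> the variables
    \<open>a\<^sub>0\<close> (index 2), \<open>a\<^sub>1\<close> (index 1) and the bridge between them (index 0).
\<close>

datatype exp =
    Var nat
  | Zero | One
  | Pi exp exp | Lam exp | App exp exp
  | Sig exp exp | Pr exp exp | Fst exp | Snd exp
  | Bool | TT | FF | Cond exp exp exp exp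
  | Bot | Abort exp exp
  | Top | Star
  | Univ
  | PathT exp exp exp | PLam exp | PApp exp exp
  | Coe exp exp exp exp
  | HCom exp exp exp exp "tube list"
  | V exp exp exp exp | VIn exp exp exp | VProj exp exp exp
  | Bridge exp exp exp | BLam exp | BApp exp exp
  | Extent exp exp exp exp exp
  | Gel exp exp exp exp | GelIn exp exp exp exp | Ungel exp
and tube = Tube ival exp exp exp

subsection \<open>Renaming and substitution\<close>

definition upr :: "(nat \<Rightarrow> nat) \<Rightarrow> nat \<Rightarrow> nat" where
  "upr \<rho> = case_nat 0 (\<lambda>n. Suc (\<rho> n))"

primrec ren :: "(nat \<Rightarrow> nat) \<Rightarrow> exp \<Rightarrow> exp" and ren_tube :: "(nat \<Rightarrow> nat) \<Rightarrow> tube \<Rightarrow> tube" where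
  "ren \<rho> (Var n) = Var (\<rho> n)"
| "ren \<rho> Zero = Zero"
| "ren \<rho> One = One"
| "ren \<rho> (Pi A B) = Pi (ren \<rho> A) (ren (upr \<rho>) B)"
| "ren \<rho> (Lam M) = Lam (ren (upr \<rho>) M)"
| "ren \<rho> (App M N) = App (ren \<rho> M) (ren \<rho> N)"
| "ren \<rho> (Sig A B) = Sig (ren \<rho> A) (ren (upr \<rho>) B)"
| "ren \<rho> (Pr M N) = Pr (ren \<rho> M) (ren \<rho> N)"
| "ren \<rho> (Fst M) = Fst (ren \<rho> M)"
| "ren \<rho> (Snd M) = Snd (ren \<rho> M)"
| "ren \<rho> Bool = Bool"
| "ren \<rho> TT = TT"
| "ren \<rho> FF = FF"
| "ren \<rho> (Cond C M T F) = Cond (ren (upr \<rho>) C) (ren \<rho> M) (ren \<rho> T) (ren \<rho> F)"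
| "ren \<rho> Bot = Bot"
| "ren \<rho> (Abort A M) = Abort (ren \<rho> A) (ren \<rho> M)"
| "ren \<rho> Top = Top"
| "ren \<rho> Star = Star"
| "ren \<rho> Univ = Univ"
| "ren \<rho> (PathT A M N) = PathT (ren (upr \<rho>) A) (ren \<rho> M) (ren \<rho> N)"
| "ren \<rho> (PLam M) = PLam (ren (upr \<rho>) M)"
| "ren \<rho> (PApp M r) = PApp (ren \<rho> M) (ren \<rho> r)"
| "ren \<rho> (Coe r s A M) = Coe (ren \<rho> r) (ren \<rho> s) (ren (upr \<rho>) A) (ren \<rho> M)"
| "ren \<rho> (HCom r s A M ts) =
     HCom (ren \<rho> r) (ren \<rho> s) (ren \<rho> A) (ren \<rho> M) (map (\<lambda>t. ren_tube \<rho> t) ts)"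
| "ren \<rho> (V r A B E) = V (ren \<rho> r) (ren \<rho> A) (ren \<rho> B) (ren \<rho> E)"
| "ren \<rho> (VIn r M N) = VIn (ren \<rho> r) (ren \<rho> M) (ren \<rho> N)"
| "ren \<rho> (VProj r E M) = VProj (ren \<rho> r) (ren \<rho> E) (ren \<rho> M)"
| "ren \<rho> (Bridge A M N) = Bridge (ren (upr \<rho>) A) (ren \<rho> M) (ren \<rho> N)"
| "ren \<rho> (BLam M) = BLam (ren (upr \<rho>) M)"
| "ren \<rho> (BApp M r) = BApp (ren \<rho> M) (ren \<rho> r)"
| "ren \<rho> (Extent r M N0 N1 N) =
     Extent (ren \<rho> r) (ren \<rho> M) (ren (upr \<rho>) N0) (ren (upr \<rho>) N1) (ren (upr (upr (upr \<rho>))) N)"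
| "ren \<rho> (Gel r A0 A1 R) = Gel (ren \<rho> r) (ren \<rho> A0) (ren \<rho> A1) (ren (upr (upr \<rho>)) R)"
| "ren \<rho> (GelIn r M0 M1 P) = GelIn (ren \<rho> r) (ren \<rho> M0) (ren \<rho> M1) (ren \<rho> P)"
| "ren \<rho> (Ungel Q) = Ungel (ren (upr \<rho>) Q)"
| "ren_tube \<rho> (Tube k p q N) = Tube k (ren \<rho> p) (ren \<rho> q) (ren (upr \<rho>) N)"

abbreviation wk :: "exp \<Rightarrow> exp" where "wk \<equiv> ren Suc"

definition scons :: "exp \<Rightarrow> (nat \<Rightarrow> exp) \<Rightarrow> nat \<Rightarrow> exp"  (infixr \<open>\<cdot>\<close> 70) where
  "M \<cdot> \<sigma> = case_nat M \<sigma>"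

definition ups :: "(nat \<Rightarrow> exp) \<Rightarrow> nat \<Rightarrow> exp" where
  "ups \<sigma> = Var 0 \<cdot> (\<lambda>n. wk (\<sigma> n))"

primrec sub :: "(nat \<Rightarrow> exp) \<Rightarrow> exp \<Rightarrow> exp" and sub_tube :: "(nat \<Rightarrow> exp) \<Rightarrow> tube \<Rightarrow> tube" where
  "sub \<sigma> (Var n) = \<sigma> n"
| "sub \<sigma> Zero = Zero"
| "sub \<sigma> One = One"
| "sub \<sigma> (Pi A B) = Pi (sub \<sigma> A) (sub (ups \<sigma>) B)"
| "sub \<sigma> (Lam M) = Lam (sub (ups \<sigma>) M)"
| "sub \<sigma> (App M N) = App (sub \<sigma> M) (sub \<sigma> N)"
| "sub \<sigma> (Sig A B) = Sig (sub \<sigma> A) (sub (ups \<sigma>) B)"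
| "sub \<sigma> (Pr M N) = Pr (sub \<sigma> M) (sub \<sigma> N)"
| "sub \<sigma> (Fst M) = Fst (sub \<sigma> M)"
| "sub \<sigma> (Snd M) = Snd (sub \<sigma> M)"
| "sub \<sigma> Bool = Bool"
| "sub \<sigma> TT = TT"
| "sub \<sigma> FF = FF"
| "sub \<sigma> (Cond C M T F) = Cond (sub (ups \<sigma>) C) (sub \<sigma> M) (sub \<sigma> T) (sub \<sigma> F)"
| "sub \<sigma> Bot = Bot"
| "sub \<sigma> (Abort A M) = Abort (sub \<sigma> A) (sub \<sigma> M)"
| "sub \<sigma> Top = Top"
| "sub \<sigma> Star = Star"
| "sub \<sigma> Univ = Univ"
| "sub \<sigma> (PathT A M N) = PathT (sub (ups \<sigma>) A) (sub \<sigma> M) (sub \<sigma> N)"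
| "sub \<sigma> (PLam M) = PLam (sub (ups \<sigma>) M)"
| "sub \<sigma> (PApp M r) = PApp (sub \<sigma> M) (sub \<sigma> r)"
| "sub \<sigma> (Coe r s A M) = Coe (sub \<sigma> r) (sub \<sigma> s) (sub (ups \<sigma>) A) (sub \<sigma> M)"
| "sub \<sigma> (HCom r s A M ts) =
     HCom (sub \<sigma> r) (sub \<sigma> s) (sub \<sigma> A) (sub \<sigma> M) (map (\<lambda>t. sub_tube \<sigma> t) ts)"
| "sub \<sigma> (V r A B E) = V (sub \<sigma> r) (sub \<sigma> A) (sub \<sigma> B) (sub \<sigma> E)"
| "sub \<sigma> (VIn r M N) = VIn (sub \<sigma> r) (sub \<sigma> M) (sub \<sigma> N)"
| "sub \<sigma> (VProj r E M) = VProj (sub \<sigma> r) (sub \<sigma> E) (sub \<sigma> M)"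
| "sub \<sigma> (Bridge A M N) = Bridge (sub (ups \<sigma>) A) (sub \<sigma> M) (sub \<sigma> N)"
| "sub \<sigma> (BLam M) = BLam (sub (ups \<sigma>) M)"
| "sub \<sigma> (BApp M r) = BApp (sub \<sigma> M) (sub \<sigma> r)"
| "sub \<sigma> (Extent r M N0 N1 N) =
     Extent (sub \<sigma> r) (sub \<sigma> M) (sub (ups \<sigma>) N0) (sub (ups \<sigma>) N1) (sub (ups (ups (ups \<sigma>))) N)"
| "sub \<sigma> (Gel r A0 A1 R) = Gel (sub \<sigma> r) (sub \<sigma> A0) (sub \<sigma> A1) (sub (ups (ups \<sigma>)) R)"
| "sub \<sigma> (GelIn r M0 M1 P) = GelIn (sub \<sigma> r) (sub \<sigma> M0) (sub \<sigma> M1) (sub \<sigma> P)"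
| "sub \<sigma> (Ungel Q) = Ungel (sub (ups \<sigma>) Q)"
| "sub_tube \<sigma> (Tube k p q N) = Tube k (sub \<sigma> p) (sub \<sigma> q) (sub (ups \<sigma>) N)"

abbreviation inst :: "exp \<Rightarrow> exp \<Rightarrow> exp"  (\<open>_[[_]]\<close> [1000, 0] 1000) where
  "M[[N]] \<equiv> sub (N \<cdot> Var) M"

abbreviation inst2 :: "exp \<Rightarrow> exp \<Rightarrow> exp \<Rightarrow> exp"  (\<open>_[[_,/ _]]\<close> [1000, 0, 0] 1000) where
  \<comment> \<open>the outer variable (index 1) is replaced by \<open>N1\<close>, the inner one (index 0) by \<open>N0\<close>\<close>
  "M[[N1, N0]] \<equiv> sub (N0 \<cdot> N1 \<cdot> Var) M"

definition swap :: "nat \<Rightarrow> nat" where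
  "swap n = (if n = 0 then 1 else if n = 1 then 0 else n)"

subsection \<open>Derived notions\<close>

definition arrow :: "exp \<Rightarrow> exp \<Rightarrow> exp" where "arrow A B = Pi A (wk B)"

definition neg :: "exp \<Rightarrow> exp" where "neg A = arrow A Bot"

definition path :: "exp \<Rightarrow> exp \<Rightarrow> exp \<Rightarrow> exp" where "path A M N = PathT (wk A) M N"

definition isContr :: "exp \<Rightarrow> exp" where
  "isContr A = Sig A (Pi (wk A) (path (wk (wk A)) (Var 0) (Var 1)))"

definition fiber :: "exp \<Rightarrow> exp \<Rightarrow> exp \<Rightarrow> exp \<Rightarrow> exp" where
  "fiber A B F N = Sig A (path (wk B) (App (wk F) (Var 0)) (wk N))"

definition equiv_type :: "exp \<Rightarrow> exp \<Rightarrow> exp" where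
  "equiv_type A B =
     Sig (arrow A B)
         (Pi (wk B) (isContr (fiber (wk (wk A)) (wk (wk B)) (Var 1) (Var 0))))"

primrec tmap :: "(exp \<Rightarrow> exp) \<Rightarrow> tube \<Rightarrow> tube" where
  "tmap f (Tube k p q N) = Tube k p q (f N)"

text \<open>Heterogeneous composition in the type line \<open>y. A\<close>, derived from \<open>Coe\<close> and \<open>HCom\<close>.\<close>

definition Com :: "exp \<Rightarrow> exp \<Rightarrow> exp \<Rightarrow> exp \<Rightarrow> tube list \<Rightarrow> exp" where
  "Com r s A M ts =
     HCom r s (A[[s]]) (Coe r s A M) (map (tmap (Coe (Var 0) (wk s) (ren (upr Suc) A))) ts)"

subsection \<open>Contexts\<close>

text \<open>
  Innermost entry first. Constraints \<open>Con k r s\<close> occupy no index. \<open>Removed\<close> is the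
  trace of a variable deleted by a context restriction: it keeps its index, so that
  no renaming is needed, but the variable cannot be used.
\<close>

datatype entry = Hyp exp | Dim ival | Con ival exp exp | Removed

type_synonym ctx = "entry list"

primrec wk_entry :: "entry \<Rightarrow> entry" where
  "wk_entry (Hyp A) = Hyp (wk A)"
| "wk_entry (Dim k) = Dim k"
| "wk_entry (Con k r s) = Con k (wk r) (wk s)"
| "wk_entry Removed = Removed"

fun is_con :: "entry \<Rightarrow> bool" where
  "is_con (Con k r s) = True"
| "is_con _ = False"

fun lookup :: "ctx \<Rightarrow> nat \<Rightarrow> entry" where
  "lookup [] n = Removed"
| "lookup (e # \<Gamma>) n =
     (if is_con e then lookup \<Gamma> n
      else case n of 0 \<Rightarrow> wk_entry e | Suc m \<Rightarrow> wk_entry (lookup \<Gamma> m))"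

fun constraints :: "ctx \<Rightarrow> entry set" where
  "constraints [] = {}"
| "constraints (e # \<Gamma>) =
     (if is_con e then insert e (constraints \<Gamma>) else wk_entry ` constraints \<Gamma>)"

text \<open>
  Context restriction: \<open>restrict \<Gamma> x\<close> deletes the bridge variable \<open>x\<close>, all term variables
  introduced after \<open>x\<close>, and the constraints mentioning \<open>x\<close>; path and bridge variables introduced
  after \<open>x\<close> are kept. Restriction by an endpoint does nothing.
\<close>

fun restrict_var :: "ctx \<Rightarrow> nat \<Rightarrow> ctx" where
  "restrict_var [] n = []"
| "restrict_var (Con k r s # \<Gamma>) n =
     (if r = Var n \<or> s = Var n then restrict_var \<Gamma> n else Con k r s # restrict_var \<Gamma> n)"
| "restrict_var (e # \<Gamma>) 0 = Removed # \<Gamma>"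
| "restrict_var (Hyp A # \<Gamma>) (Suc n) = Removed # restrict_var \<Gamma> n"
| "restrict_var (e # \<Gamma>) (Suc n) = e # restrict_var \<Gamma> n"

fun restrict :: "ctx \<Rightarrow> exp \<Rightarrow> ctx" where
  "restrict \<Gamma> (Var n) = restrict_var \<Gamma> n"
| "restrict \<Gamma> r = \<Gamma>"

subsection \<open>Interval judgments\<close>

inductive dim :: "ctx \<Rightarrow> ival \<Rightarrow> exp \<Rightarrow> bool" where
  "dim \<Gamma> k Zero"
| "dim \<Gamma> k One"
| "lookup \<Gamma> n = Dim k \<Longrightarrow> dim \<Gamma> k (Var n)"

inductive dim_eq :: "ctx \<Rightarrow> ival \<Rightarrow> exp \<Rightarrow> exp \<Rightarrow> bool" where
  "dim \<Gamma> k r \<Longrightarrow> dim_eq \<Gamma> k r r"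
| "dim_eq \<Gamma> k r s \<Longrightarrow> dim_eq \<Gamma> k s r"
| "dim_eq \<Gamma> k r s \<Longrightarrow> dim_eq \<Gamma> k s t \<Longrightarrow> dim_eq \<Gamma> k r t"
| "Con k r s \<in> constraints \<Gamma> \<Longrightarrow> dim \<Gamma> k r \<Longrightarrow> dim \<Gamma> k s \<Longrightarrow> dim_eq \<Gamma> k r s"

text \<open>
  Constraints on the path interval are arbitrary equations; constraints on the affine bridge
  interval can only equate a bridge term with an endpoint.
\<close>

inductive con_eq :: "ctx \<Rightarrow> entry \<Rightarrow> entry \<Rightarrow> bool" where
  "dim_eq \<Gamma> PathI r r' \<Longrightarrow> dim_eq \<Gamma> PathI s s' \<Longrightarrow> con_eq \<Gamma> (Con PathI r s) (Con PathI r' s')"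
| "dim_eq \<Gamma> BridgeI r r' \<Longrightarrow> s \<in> {Zero, One} \<Longrightarrow>
     con_eq \<Gamma> (Con BridgeI r s) (Con BridgeI r' s)"

fun holds :: "ctx \<Rightarrow> entry \<Rightarrow> bool" where
  "holds \<Gamma> (Con k r s) = dim_eq \<Gamma> k r s"
| "holds \<Gamma> _ = False"

primrec tcon :: "tube \<Rightarrow> entry" where
  "tcon (Tube k p q N) = Con k p q"

primrec tbody :: "tube \<Rightarrow> exp" where
  "tbody (Tube k p q N) = N"

text \<open>The tubes whose constraint does not mention the variable with index 0.\<close>

primrec apart0 :: "tube \<Rightarrow> bool" where
  "apart0 (Tube k p q N) \<longleftrightarrow> p \<noteq> Var 0 \<and> q \<noteq> Var 0"

subsection \<open>Typing and judgmental equality\<close>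

text \<open>
  \<open>\<Gamma> \<turnstile>\<^bsub>l\<^esub> A \<doteq> B\<close> is equality of types, where the small types (\<open>l = Small\<close>) are
  the elements of the universe; \<open>\<Gamma> \<turnstile> M \<doteq> N \<Colon> A\<close> is equality of terms. Being a type, respectively
  an element, is the reflexive instance of these judgments, so that each rule below is at the same
  time the typing rule and the congruence rule of a constructor.
  \<open>tubes \<Gamma> r A M ts ts'\<close> states that \<open>ts\<close> and \<open>ts'\<close> are equal compatible families of tubes in \<open>A\<close>,
  adjacent at \<open>r\<close> to the cap \<open>M\<close>.
  \<open>branches \<Delta> A B N\<^sub>0 N\<^sub>1 N N\<^sub>0' N\<^sub>1' N'\<close> collects the premises on the clauses of \<open>Extent\<close>.

  The equations for Kan operations are those at \<open>\<Pi>\<close>, \<open>\<Sigma>\<close>, path, bridge and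
  \<open>Gel\<close> types, and for coercion at the constant base types. At the remaining types (univalence
  types \<open>V\<close>, composites of types, composition of booleans) cartesian cubical type theories
  disagree about these equations; there only the general boundary equations are imposed.
\<close>

datatype size = Small | Large

inductive
  is_ctx :: "ctx \<Rightarrow> bool" and
  ty_eq :: "ctx \<Rightarrow> size \<Rightarrow> exp \<Rightarrow> exp \<Rightarrow> bool"  (\<open>_ \<turnstile>\<^bsub>_\<^esub> _ \<doteq> _\<close> [50, 0, 51, 51] 50) and
  tm_eq :: "ctx \<Rightarrow> exp \<Rightarrow> exp \<Rightarrow> exp \<Rightarrow> bool"  (\<open>_ \<turnstile> _ \<doteq> _ \<Colon> _\<close> [50, 51, 51, 51] 50) and
  tubes :: "ctx \<Rightarrow> exp \<Rightarrow> exp \<Rightarrow> exp \<Rightarrow> tube list \<Rightarrow> tube list \<Rightarrow> bool" and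
  branches :: "ctx \<Rightarrow> exp \<Rightarrow> exp \<Rightarrow> exp \<Rightarrow> exp \<Rightarrow> exp \<Rightarrow> exp \<Rightarrow> exp \<Rightarrow> exp \<Rightarrow> bool" and
  ty :: "ctx \<Rightarrow> size \<Rightarrow> exp \<Rightarrow> bool"  (\<open>_ \<turnstile>\<^bsub>_\<^esub> _\<close> [50, 0, 51] 50) and
  tm :: "ctx \<Rightarrow> exp \<Rightarrow> exp \<Rightarrow> bool"  (\<open>_ \<turnstile> _ \<Colon> _\<close> [50, 51, 51] 50)
where
  "\<Gamma> \<turnstile>\<^bsub>l\<^esub> A \<equiv> \<Gamma> \<turnstile>\<^bsub>l\<^esub> A \<doteq> A"
| "\<Gamma> \<turnstile> M \<Colon> A \<equiv> \<Gamma> \<turnstile> M \<doteq> M \<Colon> A"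

  \<comment> \<open>contexts\<close>
| ctx_nil: "is_ctx []"
| ctx_hyp: "is_ctx \<Gamma> \<Longrightarrow> \<Gamma> \<turnstile>\<^bsub>Large\<^esub> A \<Longrightarrow> is_ctx (Hyp A # \<Gamma>)"
| ctx_dim: "is_ctx \<Gamma> \<Longrightarrow> is_ctx (Dim k # \<Gamma>)"
| ctx_con: "is_ctx \<Gamma> \<Longrightarrow> con_eq \<Gamma> (Con k r s) (Con k r s) \<Longrightarrow> is_ctx (Con k r s # \<Gamma>)"
| ctx_removed: "is_ctx \<Gamma> \<Longrightarrow> is_ctx (Removed # \<Gamma>)"

  \<comment> \<open>structural rules\<close>
| ty_sym: "\<Gamma> \<turnstile>\<^bsub>l\<^esub> A \<doteq> B \<Longrightarrow> \<Gamma> \<turnstile>\<^bsub>l\<^esub> B \<doteq> A"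
| ty_trans: "\<Gamma> \<turnstile>\<^bsub>l\<^esub> A \<doteq> B \<Longrightarrow> \<Gamma> \<turnstile>\<^bsub>l\<^esub> B \<doteq> C \<Longrightarrow> \<Gamma> \<turnstile>\<^bsub>l\<^esub> A \<doteq> C"
| tm_sym: "\<Gamma> \<turnstile> M \<doteq> N \<Colon> A \<Longrightarrow> \<Gamma> \<turnstile> N \<doteq> M \<Colon> A"
| tm_trans: "\<Gamma> \<turnstile> M \<doteq> N \<Colon> A \<Longrightarrow> \<Gamma> \<turnstile> N \<doteq> P \<Colon> A \<Longrightarrow> \<Gamma> \<turnstile> M \<doteq> P \<Colon> A"
| tm_conv: "\<Gamma> \<turnstile> M \<doteq> N \<Colon> A \<Longrightarrow> \<Gamma> \<turnstile>\<^bsub>Large\<^esub> A \<doteq> B \<Longrightarrow> \<Gamma> \<turnstile> M \<doteq> N \<Colon> B"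
| tm_var: "is_ctx \<Gamma> \<Longrightarrow> lookup \<Gamma> n = Hyp A \<Longrightarrow> \<Gamma> \<turnstile> Var n \<Colon> A"

  \<comment> \<open>everything holds under an inconsistent constraint\<close>
| ty_incons: "dim_eq \<Gamma> k Zero One \<Longrightarrow> \<Gamma> \<turnstile>\<^bsub>l\<^esub> A \<Longrightarrow> \<Gamma> \<turnstile>\<^bsub>l\<^esub> B \<Longrightarrow> \<Gamma> \<turnstile>\<^bsub>l\<^esub> A \<doteq> B"
| tm_incons: "dim_eq \<Gamma> k Zero One \<Longrightarrow> \<Gamma> \<turnstile> M \<Colon> A \<Longrightarrow> \<Gamma> \<turnstile> N \<Colon> A \<Longrightarrow> \<Gamma> \<turnstile> M \<doteq> N \<Colon> A"

  \<comment> \<open>the universe\<close>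
| univ_F: "is_ctx \<Gamma> \<Longrightarrow> \<Gamma> \<turnstile>\<^bsub>Large\<^esub> Univ"
| univ_I: "\<Gamma> \<turnstile>\<^bsub>Small\<^esub> A \<doteq> B \<Longrightarrow> \<Gamma> \<turnstile> A \<doteq> B \<Colon> Univ"
| univ_E: "\<Gamma> \<turnstile> A \<doteq> B \<Colon> Univ \<Longrightarrow> \<Gamma> \<turnstile>\<^bsub>Small\<^esub> A \<doteq> B"
| ty_lift: "\<Gamma> \<turnstile>\<^bsub>Small\<^esub> A \<doteq> B \<Longrightarrow> \<Gamma> \<turnstile>\<^bsub>Large\<^esub> A \<doteq> B"

  \<comment> \<open>dependent functions\<close>
| pi_F: "\<Gamma> \<turnstile>\<^bsub>l\<^esub> A \<doteq> A' \<Longrightarrow> Hyp A # \<Gamma> \<turnstile>\<^bsub>l\<^esub> B \<doteq> B' \<Longrightarrow> \<Gamma> \<turnstile>\<^bsub>l\<^esub> Pi A B \<doteq> Pi A' B'"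
| pi_I: "\<Gamma> \<turnstile>\<^bsub>Large\<^esub> A \<Longrightarrow> Hyp A # \<Gamma> \<turnstile> M \<doteq> M' \<Colon> B \<Longrightarrow> \<Gamma> \<turnstile> Lam M \<doteq> Lam M' \<Colon> Pi A B"
| pi_E: "\<Gamma> \<turnstile> M \<doteq> M' \<Colon> Pi A B \<Longrightarrow> \<Gamma> \<turnstile> N \<doteq> N' \<Colon> A \<Longrightarrow> \<Gamma> \<turnstile> App M N \<doteq> App M' N' \<Colon> B[[N]]"
| pi_beta: "Hyp A # \<Gamma> \<turnstile> M \<Colon> B \<Longrightarrow> \<Gamma> \<turnstile> N \<Colon> A \<Longrightarrow> \<Gamma> \<turnstile> App (Lam M) N \<doteq> M[[N]] \<Colon> B[[N]]"
| pi_eta: "\<Gamma> \<turnstile> M \<Colon> Pi A B \<Longrightarrow> \<Gamma> \<turnstile> M \<doteq> Lam (App (wk M) (Var 0)) \<Colon> Pi A B"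

  \<comment> \<open>dependent pairs\<close>
| sig_F: "\<Gamma> \<turnstile>\<^bsub>l\<^esub> A \<doteq> A' \<Longrightarrow> Hyp A # \<Gamma> \<turnstile>\<^bsub>l\<^esub> B \<doteq> B' \<Longrightarrow> \<Gamma> \<turnstile>\<^bsub>l\<^esub> Sig A B \<doteq> Sig A' B'"
| sig_I: "Hyp A # \<Gamma> \<turnstile>\<^bsub>Large\<^esub> B \<Longrightarrow> \<Gamma> \<turnstile> M \<doteq> M' \<Colon> A \<Longrightarrow> \<Gamma> \<turnstile> N \<doteq> N' \<Colon> B[[M]] \<Longrightarrow>
    \<Gamma> \<turnstile> Pr M N \<doteq> Pr M' N' \<Colon> Sig A B"
| sig_E1: "\<Gamma> \<turnstile> M \<doteq> M' \<Colon> Sig A B \<Longrightarrow> \<Gamma> \<turnstile> Fst M \<doteq> Fst M' \<Colon> A"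
| sig_E2: "\<Gamma> \<turnstile> M \<doteq> M' \<Colon> Sig A B \<Longrightarrow> \<Gamma> \<turnstile> Snd M \<doteq> Snd M' \<Colon> B[[Fst M]]"
| sig_beta1: "Hyp A # \<Gamma> \<turnstile>\<^bsub>Large\<^esub> B \<Longrightarrow> \<Gamma> \<turnstile> M \<Colon> A \<Longrightarrow> \<Gamma> \<turnstile> N \<Colon> B[[M]] \<Longrightarrow>
    \<Gamma> \<turnstile> Fst (Pr M N) \<doteq> M \<Colon> A"
| sig_beta2: "Hyp A # \<Gamma> \<turnstile>\<^bsub>Large\<^esub> B \<Longrightarrow> \<Gamma> \<turnstile> M \<Colon> A \<Longrightarrow> \<Gamma> \<turnstile> N \<Colon> B[[M]] \<Longrightarrow>
    \<Gamma> \<turnstile> Snd (Pr M N) \<doteq> N \<Colon> B[[M]]"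
| sig_eta: "\<Gamma> \<turnstile> M \<Colon> Sig A B \<Longrightarrow> \<Gamma> \<turnstile> M \<doteq> Pr (Fst M) (Snd M) \<Colon> Sig A B"

  \<comment> \<open>booleans, empty type, unit type\<close>
| bool_F: "is_ctx \<Gamma> \<Longrightarrow> \<Gamma> \<turnstile>\<^bsub>Small\<^esub> Bool"
| bool_I1: "is_ctx \<Gamma> \<Longrightarrow> \<Gamma> \<turnstile> TT \<Colon> Bool"
| bool_I2: "is_ctx \<Gamma> \<Longrightarrow> \<Gamma> \<turnstile> FF \<Colon> Bool"
| bool_E: "Hyp Bool # \<Gamma> \<turnstile>\<^bsub>Large\<^esub> C \<doteq> C' \<Longrightarrow> \<Gamma> \<turnstile> M \<doteq> M' \<Colon> Bool \<Longrightarrow>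
    \<Gamma> \<turnstile> T \<doteq> T' \<Colon> C[[TT]] \<Longrightarrow> \<Gamma> \<turnstile> F \<doteq> F' \<Colon> C[[FF]] \<Longrightarrow>
    \<Gamma> \<turnstile> Cond C M T F \<doteq> Cond C' M' T' F' \<Colon> C[[M]]"
| bool_beta1: "Hyp Bool # \<Gamma> \<turnstile>\<^bsub>Large\<^esub> C \<Longrightarrow> \<Gamma> \<turnstile> T \<Colon> C[[TT]] \<Longrightarrow> \<Gamma> \<turnstile> F \<Colon> C[[FF]] \<Longrightarrow>
    \<Gamma> \<turnstile> Cond C TT T F \<doteq> T \<Colon> C[[TT]]"
| bool_beta2: "Hyp Bool # \<Gamma> \<turnstile>\<^bsub>Large\<^esub> C \<Longrightarrow> \<Gamma> \<turnstile> T \<Colon> C[[TT]] \<Longrightarrow> \<Gamma> \<turnstile> F \<Colon> C[[FF]] \<Longrightarrow>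
    \<Gamma> \<turnstile> Cond C FF T F \<doteq> F \<Colon> C[[FF]]"
| bot_F: "is_ctx \<Gamma> \<Longrightarrow> \<Gamma> \<turnstile>\<^bsub>Small\<^esub> Bot"
| bot_E: "\<Gamma> \<turnstile>\<^bsub>Large\<^esub> A \<doteq> A' \<Longrightarrow> \<Gamma> \<turnstile> M \<doteq> M' \<Colon> Bot \<Longrightarrow> \<Gamma> \<turnstile> Abort A M \<doteq> Abort A' M' \<Colon> A"
| top_F: "is_ctx \<Gamma> \<Longrightarrow> \<Gamma> \<turnstile>\<^bsub>Small\<^esub> Top"
| top_I: "is_ctx \<Gamma> \<Longrightarrow> \<Gamma> \<turnstile> Star \<Colon> Top"
| top_eta: "\<Gamma> \<turnstile> M \<Colon> Top \<Longrightarrow> \<Gamma> \<turnstile> M \<doteq> Star \<Colon> Top"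

  \<comment> \<open>path types\<close>
| path_F: "Dim PathI # \<Gamma> \<turnstile>\<^bsub>l\<^esub> A \<doteq> A' \<Longrightarrow> \<Gamma> \<turnstile> M0 \<doteq> M0' \<Colon> A[[Zero]] \<Longrightarrow> \<Gamma> \<turnstile> M1 \<doteq> M1' \<Colon> A[[One]] \<Longrightarrow>
    \<Gamma> \<turnstile>\<^bsub>l\<^esub> PathT A M0 M1 \<doteq> PathT A' M0' M1'"
| path_I: "Dim PathI # \<Gamma> \<turnstile>\<^bsub>Large\<^esub> A \<Longrightarrow> Dim PathI # \<Gamma> \<turnstile> M \<doteq> M' \<Colon> A \<Longrightarrow>
    \<Gamma> \<turnstile> M[[Zero]] \<doteq> M0 \<Colon> A[[Zero]] \<Longrightarrow> \<Gamma> \<turnstile> M[[One]] \<doteq> M1 \<Colon> A[[One]] \<Longrightarrow>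
    \<Gamma> \<turnstile> PLam M \<doteq> PLam M' \<Colon> PathT A M0 M1"
| path_E: "\<Gamma> \<turnstile> P \<doteq> P' \<Colon> PathT A M0 M1 \<Longrightarrow> dim_eq \<Gamma> PathI r r' \<Longrightarrow>
    \<Gamma> \<turnstile> PApp P r \<doteq> PApp P' r' \<Colon> A[[r]]"
| path_E0: "\<Gamma> \<turnstile> P \<Colon> PathT A M0 M1 \<Longrightarrow> \<Gamma> \<turnstile> PApp P Zero \<doteq> M0 \<Colon> A[[Zero]]"
| path_E1: "\<Gamma> \<turnstile> P \<Colon> PathT A M0 M1 \<Longrightarrow> \<Gamma> \<turnstile> PApp P One \<doteq> M1 \<Colon> A[[One]]"
| path_beta: "Dim PathI # \<Gamma> \<turnstile> M \<Colon> A \<Longrightarrow> dim \<Gamma> PathI r \<Longrightarrow>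
    \<Gamma> \<turnstile> PApp (PLam M) r \<doteq> M[[r]] \<Colon> A[[r]]"
| path_eta: "\<Gamma> \<turnstile> P \<Colon> PathT A M0 M1 \<Longrightarrow>
    \<Gamma> \<turnstile> P \<doteq> PLam (PApp (wk P) (Var 0)) \<Colon> PathT A M0 M1"

  \<comment> \<open>Kan operations\<close>
| coe: "dim_eq \<Gamma> PathI r r' \<Longrightarrow> dim_eq \<Gamma> PathI s s' \<Longrightarrow> Dim PathI # \<Gamma> \<turnstile>\<^bsub>Large\<^esub> A \<doteq> A' \<Longrightarrow>
    \<Gamma> \<turnstile> M \<doteq> M' \<Colon> A[[r]] \<Longrightarrow> \<Gamma> \<turnstile> Coe r s A M \<doteq> Coe r' s' A' M' \<Colon> A[[s]]"
| coe_cap: "\<Gamma> \<turnstile> Coe r r A M \<Colon> A[[r]] \<Longrightarrow> \<Gamma> \<turnstile> M \<Colon> A[[r]] \<Longrightarrow> \<Gamma> \<turnstile> Coe r r A M \<doteq> M \<Colon> A[[r]]"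
| tubes: "length ts = length ts' \<Longrightarrow>
    (\<And>i. i < length ts \<Longrightarrow> con_eq \<Gamma> (tcon (ts ! i)) (tcon (ts' ! i))) \<Longrightarrow>
    (\<And>i. i < length ts \<Longrightarrow>
       Dim PathI # tcon (ts ! i) # \<Gamma> \<turnstile> tbody (ts ! i) \<doteq> tbody (ts' ! i) \<Colon> wk A) \<Longrightarrow>
    (\<And>i. i < length ts \<Longrightarrow> tcon (ts ! i) # \<Gamma> \<turnstile> (tbody (ts ! i))[[r]] \<doteq> M \<Colon> A) \<Longrightarrow>
    (\<And>i j. i < length ts \<Longrightarrow> j < length ts \<Longrightarrow>
       Dim PathI # tcon (ts ! j) # tcon (ts ! i) # \<Gamma> \<turnstile> tbody (ts ! i) \<doteq> tbody (ts ! j) \<Colon> wk A) \<Longrightarrow>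
    tubes \<Gamma> r A M ts ts'"
| hcom: "dim_eq \<Gamma> PathI r r' \<Longrightarrow> dim_eq \<Gamma> PathI s s' \<Longrightarrow> \<Gamma> \<turnstile>\<^bsub>Large\<^esub> A \<doteq> A' \<Longrightarrow>
    \<Gamma> \<turnstile> M \<doteq> M' \<Colon> A \<Longrightarrow> tubes \<Gamma> r A M ts ts' \<Longrightarrow>
    \<Gamma> \<turnstile> HCom r s A M ts \<doteq> HCom r' s' A' M' ts' \<Colon> A"
| hcom_cap: "dim \<Gamma> PathI r \<Longrightarrow> \<Gamma> \<turnstile>\<^bsub>Large\<^esub> A \<Longrightarrow> \<Gamma> \<turnstile> M \<Colon> A \<Longrightarrow> tubes \<Gamma> r A M ts ts \<Longrightarrow>
    \<Gamma> \<turnstile> HCom r r A M ts \<doteq> M \<Colon> A"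
| hcom_tube: "dim \<Gamma> PathI r \<Longrightarrow> dim \<Gamma> PathI s \<Longrightarrow> \<Gamma> \<turnstile>\<^bsub>Large\<^esub> A \<Longrightarrow> \<Gamma> \<turnstile> M \<Colon> A \<Longrightarrow>
    tubes \<Gamma> r A M ts ts \<Longrightarrow> i < length ts \<Longrightarrow> holds \<Gamma> (tcon (ts ! i)) \<Longrightarrow>
    \<Gamma> \<turnstile> HCom r s A M ts \<doteq> (tbody (ts ! i))[[s]] \<Colon> A"

  \<comment> \<open>univalence: the type \<open>V r A B E\<close> is \<open>A\<close> at \<open>r = 0\<close> and \<open>B\<close> at \<open>r = 1\<close>; \<open>A\<close> and
      the equivalence \<open>E\<close> are only required to exist under the constraint \<open>r = 0\<close>\<close>
| v_F: "dim_eq \<Gamma> PathI r r' \<Longrightarrow> Con PathI r Zero # \<Gamma> \<turnstile>\<^bsub>l\<^esub> A \<doteq> A' \<Longrightarrow> \<Gamma> \<turnstile>\<^bsub>l\<^esub> B \<doteq> B' \<Longrightarrow>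
    Con PathI r Zero # \<Gamma> \<turnstile> E \<doteq> E' \<Colon> equiv_type A B \<Longrightarrow> \<Gamma> \<turnstile>\<^bsub>l\<^esub> V r A B E \<doteq> V r' A' B' E'"
| v_F0: "\<Gamma> \<turnstile>\<^bsub>l\<^esub> A \<Longrightarrow> \<Gamma> \<turnstile>\<^bsub>l\<^esub> V Zero A B E \<Longrightarrow> \<Gamma> \<turnstile>\<^bsub>l\<^esub> V Zero A B E \<doteq> A"
| v_F1: "\<Gamma> \<turnstile>\<^bsub>l\<^esub> B \<Longrightarrow> \<Gamma> \<turnstile>\<^bsub>l\<^esub> V One A B E \<Longrightarrow> \<Gamma> \<turnstile>\<^bsub>l\<^esub> V One A B E \<doteq> B"
| v_I: "\<Gamma> \<turnstile>\<^bsub>Large\<^esub> V r A B E \<Longrightarrow> dim_eq \<Gamma> PathI r r' \<Longrightarrow>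
    Con PathI r Zero # \<Gamma> \<turnstile> M \<doteq> M' \<Colon> A \<Longrightarrow> \<Gamma> \<turnstile> N \<doteq> N' \<Colon> B \<Longrightarrow>
    Con PathI r Zero # \<Gamma> \<turnstile> App (Fst E) M \<doteq> N \<Colon> B \<Longrightarrow>
    \<Gamma> \<turnstile> VIn r M N \<doteq> VIn r' M' N' \<Colon> V r A B E"
| v_I0: "\<Gamma> \<turnstile> M \<Colon> A \<Longrightarrow> \<Gamma> \<turnstile> VIn Zero M N \<Colon> V Zero A B E \<Longrightarrow> \<Gamma> \<turnstile> VIn Zero M N \<doteq> M \<Colon> A"
| v_I1: "\<Gamma> \<turnstile> N \<Colon> B \<Longrightarrow> \<Gamma> \<turnstile> VIn One M N \<Colon> V One A B E \<Longrightarrow> \<Gamma> \<turnstile> VIn One M N \<doteq> N \<Colon> B"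
| v_E: "\<Gamma> \<turnstile>\<^bsub>Large\<^esub> V r A B E \<Longrightarrow> dim_eq \<Gamma> PathI r r' \<Longrightarrow>
    Con PathI r Zero # \<Gamma> \<turnstile> E \<doteq> E' \<Colon> equiv_type A B \<Longrightarrow> \<Gamma> \<turnstile>\<^bsub>Large\<^esub> B \<Longrightarrow>
    \<Gamma> \<turnstile> P \<doteq> P' \<Colon> V r A B E \<Longrightarrow> \<Gamma> \<turnstile> VProj r E P \<doteq> VProj r' E' P' \<Colon> B"
| v_E0: "\<Gamma> \<turnstile> E \<Colon> equiv_type A B \<Longrightarrow> \<Gamma> \<turnstile> P \<Colon> A \<Longrightarrow> \<Gamma> \<turnstile>\<^bsub>Large\<^esub> A \<Longrightarrow> \<Gamma> \<turnstile>\<^bsub>Large\<^esub> B \<Longrightarrow>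
    \<Gamma> \<turnstile> VProj Zero E P \<doteq> App (Fst E) P \<Colon> B"
| v_E1: "\<Gamma> \<turnstile>\<^bsub>Large\<^esub> V One A B E \<Longrightarrow> \<Gamma> \<turnstile> P \<Colon> B \<Longrightarrow> \<Gamma> \<turnstile> VProj One E P \<doteq> P \<Colon> B"
| v_beta: "\<Gamma> \<turnstile>\<^bsub>Large\<^esub> V r A B E \<Longrightarrow> dim \<Gamma> PathI r \<Longrightarrow> Con PathI r Zero # \<Gamma> \<turnstile> M \<Colon> A \<Longrightarrow> \<Gamma> \<turnstile> N \<Colon> B \<Longrightarrow>
    Con PathI r Zero # \<Gamma> \<turnstile> E \<Colon> equiv_type A B \<Longrightarrow>
    Con PathI r Zero # \<Gamma> \<turnstile> App (Fst E) M \<doteq> N \<Colon> B \<Longrightarrow>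
    \<Gamma> \<turnstile> VProj r E (VIn r M N) \<doteq> N \<Colon> B"
| v_eta: "\<Gamma> \<turnstile>\<^bsub>Large\<^esub> V r A B E \<Longrightarrow> \<Gamma> \<turnstile> P \<Colon> V r A B E \<Longrightarrow>
    \<Gamma> \<turnstile> P \<doteq> VIn r P (VProj r E P) \<Colon> V r A B E"

  \<comment> \<open>bridge types\<close>
| bridge_F: "Dim BridgeI # \<Gamma> \<turnstile>\<^bsub>l\<^esub> A \<doteq> A' \<Longrightarrow> \<Gamma> \<turnstile> M0 \<doteq> M0' \<Colon> A[[Zero]] \<Longrightarrow> \<Gamma> \<turnstile> M1 \<doteq> M1' \<Colon> A[[One]] \<Longrightarrow>
    \<Gamma> \<turnstile>\<^bsub>l\<^esub> Bridge A M0 M1 \<doteq> Bridge A' M0' M1'"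
| bridge_I: "Dim BridgeI # \<Gamma> \<turnstile>\<^bsub>Large\<^esub> A \<Longrightarrow> Dim BridgeI # \<Gamma> \<turnstile> M \<doteq> M' \<Colon> A \<Longrightarrow>
    \<Gamma> \<turnstile> M[[Zero]] \<doteq> M0 \<Colon> A[[Zero]] \<Longrightarrow> \<Gamma> \<turnstile> M[[One]] \<doteq> M1 \<Colon> A[[One]] \<Longrightarrow>
    \<Gamma> \<turnstile> BLam M \<doteq> BLam M' \<Colon> Bridge A M0 M1"
| bridge_E: "is_ctx \<Gamma> \<Longrightarrow> dim \<Gamma> BridgeI r \<Longrightarrow> restrict \<Gamma> r \<turnstile> P \<doteq> P' \<Colon> Bridge A M0 M1 \<Longrightarrow>
    \<Gamma> \<turnstile> BApp P r \<doteq> BApp P' r \<Colon> A[[r]]"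
| bridge_E0: "is_ctx \<Gamma> \<Longrightarrow> dim_eq \<Gamma> BridgeI r Zero \<Longrightarrow> restrict \<Gamma> r \<turnstile> P \<Colon> Bridge A M0 M1 \<Longrightarrow>
    \<Gamma> \<turnstile> BApp P r \<doteq> M0 \<Colon> A[[r]]"
| bridge_E1: "is_ctx \<Gamma> \<Longrightarrow> dim_eq \<Gamma> BridgeI r One \<Longrightarrow> restrict \<Gamma> r \<turnstile> P \<Colon> Bridge A M0 M1 \<Longrightarrow>
    \<Gamma> \<turnstile> BApp P r \<doteq> M1 \<Colon> A[[r]]"
| bridge_beta: "is_ctx \<Gamma> \<Longrightarrow> dim \<Gamma> BridgeI r \<Longrightarrow> Dim BridgeI # restrict \<Gamma> r \<turnstile> M \<Colon> A \<Longrightarrow>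
    \<Gamma> \<turnstile> BApp (BLam M) r \<doteq> M[[r]] \<Colon> A[[r]]"
| bridge_eta: "\<Gamma> \<turnstile> P \<Colon> Bridge A M0 M1 \<Longrightarrow>
    \<Gamma> \<turnstile> P \<doteq> BLam (BApp (wk P) (Var 0)) \<Colon> Bridge A M0 M1"

  \<comment> \<open>extent: \<open>A\<close> lives over a bridge variable \<open>x\<close>, \<open>B\<close> over \<open>x\<close> and \<open>a : A\<close>\<close>
| branches: "Dim BridgeI # \<Delta> \<turnstile>\<^bsub>Large\<^esub> A \<Longrightarrow> Hyp A # Dim BridgeI # \<Delta> \<turnstile>\<^bsub>Large\<^esub> B \<Longrightarrow>
    Hyp (A[[Zero]]) # \<Delta> \<turnstile> N0 \<doteq> N0' \<Colon> sub (Var 0 \<cdot> Zero \<cdot> (\<lambda>n. Var (n + 1))) B \<Longrightarrow>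
    Hyp (A[[One]]) # \<Delta> \<turnstile> N1 \<doteq> N1' \<Colon> sub (Var 0 \<cdot> One \<cdot> (\<lambda>n. Var (n + 1))) B \<Longrightarrow>
    Hyp (Bridge (ren (upr (\<lambda>n. n + 2)) A) (Var 1) (Var 0)) # Hyp (wk (A[[One]])) # Hyp (A[[Zero]]) # \<Delta>
      \<turnstile> N \<doteq> N' \<Colon> Bridge (sub (BApp (Var 1) (Var 0) \<cdot> Var 0 \<cdot> (\<lambda>n. Var (n + 4))) B)
                      (sub (Var 2 \<cdot> (\<lambda>n. Var (n + 3))) N0)
                      (sub (Var 1 \<cdot> (\<lambda>n. Var (n + 3))) N1) \<Longrightarrow>
    branches \<Delta> A B N0 N1 N N0' N1' N'"
| extent: "is_ctx \<Gamma> \<Longrightarrow> dim \<Gamma> BridgeI r \<Longrightarrow> branches (restrict \<Gamma> r) A B N0 N1 N N0' N1' N' \<Longrightarrow>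
    \<Gamma> \<turnstile> M \<doteq> M' \<Colon> A[[r]] \<Longrightarrow>
    \<Gamma> \<turnstile> Extent r M N0 N1 N \<doteq> Extent r M' N0' N1' N' \<Colon> B[[r, M]]"
| extent_0: "is_ctx \<Gamma> \<Longrightarrow> dim_eq \<Gamma> BridgeI r Zero \<Longrightarrow> branches (restrict \<Gamma> r) A B N0 N1 N N0 N1 N \<Longrightarrow>
    \<Gamma> \<turnstile> M \<Colon> A[[r]] \<Longrightarrow> \<Gamma> \<turnstile> Extent r M N0 N1 N \<doteq> N0[[M]] \<Colon> B[[r, M]]"
| extent_1: "is_ctx \<Gamma> \<Longrightarrow> dim_eq \<Gamma> BridgeI r One \<Longrightarrow> branches (restrict \<Gamma> r) A B N0 N1 N N0 N1 N \<Longrightarrow>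
    \<Gamma> \<turnstile> M \<Colon> A[[r]] \<Longrightarrow> \<Gamma> \<turnstile> Extent r M N0 N1 N \<doteq> N1[[M]] \<Colon> B[[r, M]]"
| extent_beta: "is_ctx \<Gamma> \<Longrightarrow> dim \<Gamma> BridgeI r \<Longrightarrow> branches (restrict \<Gamma> r) A B N0 N1 N N0 N1 N \<Longrightarrow>
    Dim BridgeI # restrict \<Gamma> r \<turnstile> M \<Colon> A \<Longrightarrow>
    \<Gamma> \<turnstile> Extent r (M[[r]]) N0 N1 N
       \<doteq> BApp (sub (BLam M \<cdot> M[[One]] \<cdot> M[[Zero]] \<cdot> Var) N) r \<Colon> B[[r, M[[r]]]]"

  \<comment> \<open>Gel-types\<close>
| gel_F: "is_ctx \<Gamma> \<Longrightarrow> dim \<Gamma> BridgeI r \<Longrightarrow> restrict \<Gamma> r \<turnstile>\<^bsub>l\<^esub> A0 \<doteq> A0' \<Longrightarrow> restrict \<Gamma> r \<turnstile>\<^bsub>l\<^esub> A1 \<doteq> A1' \<Longrightarrow>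
    Hyp (wk A1) # Hyp A0 # restrict \<Gamma> r \<turnstile>\<^bsub>l\<^esub> R \<doteq> R' \<Longrightarrow>
    \<Gamma> \<turnstile>\<^bsub>l\<^esub> Gel r A0 A1 R \<doteq> Gel r A0' A1' R'"
| gel_F0: "dim_eq \<Gamma> BridgeI r Zero \<Longrightarrow> \<Gamma> \<turnstile>\<^bsub>l\<^esub> A0 \<Longrightarrow> \<Gamma> \<turnstile>\<^bsub>l\<^esub> Gel r A0 A1 R \<Longrightarrow> \<Gamma> \<turnstile>\<^bsub>l\<^esub> Gel r A0 A1 R \<doteq> A0"
| gel_F1: "dim_eq \<Gamma> BridgeI r One \<Longrightarrow> \<Gamma> \<turnstile>\<^bsub>l\<^esub> A1 \<Longrightarrow> \<Gamma> \<turnstile>\<^bsub>l\<^esub> Gel r A0 A1 R \<Longrightarrow> \<Gamma> \<turnstile>\<^bsub>l\<^esub> Gel r A0 A1 R \<doteq> A1"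
| gel_I: "is_ctx \<Gamma> \<Longrightarrow> dim \<Gamma> BridgeI r \<Longrightarrow> \<Gamma> \<turnstile>\<^bsub>Large\<^esub> Gel r A0 A1 R \<Longrightarrow>
    restrict \<Gamma> r \<turnstile> M0 \<doteq> M0' \<Colon> A0 \<Longrightarrow> restrict \<Gamma> r \<turnstile> M1 \<doteq> M1' \<Colon> A1 \<Longrightarrow>
    restrict \<Gamma> r \<turnstile> P \<doteq> P' \<Colon> R[[M0, M1]] \<Longrightarrow>
    \<Gamma> \<turnstile> GelIn r M0 M1 P \<doteq> GelIn r M0' M1' P' \<Colon> Gel r A0 A1 R"
| gel_I0: "dim_eq \<Gamma> BridgeI r Zero \<Longrightarrow> \<Gamma> \<turnstile> M0 \<Colon> A0 \<Longrightarrow> \<Gamma> \<turnstile> GelIn r M0 M1 P \<Colon> Gel r A0 A1 R \<Longrightarrow>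
    \<Gamma> \<turnstile> GelIn r M0 M1 P \<doteq> M0 \<Colon> A0"
| gel_I1: "dim_eq \<Gamma> BridgeI r One \<Longrightarrow> \<Gamma> \<turnstile> M1 \<Colon> A1 \<Longrightarrow> \<Gamma> \<turnstile> GelIn r M0 M1 P \<Colon> Gel r A0 A1 R \<Longrightarrow>
    \<Gamma> \<turnstile> GelIn r M0 M1 P \<doteq> M1 \<Colon> A1"
| gel_E: "\<Gamma> \<turnstile>\<^bsub>Large\<^esub> A0 \<Longrightarrow> \<Gamma> \<turnstile>\<^bsub>Large\<^esub> A1 \<Longrightarrow> Hyp (wk A1) # Hyp A0 # \<Gamma> \<turnstile>\<^bsub>Large\<^esub> R \<Longrightarrow>
    Dim BridgeI # \<Gamma> \<turnstile> Q \<doteq> Q' \<Colon> Gel (Var 0) (wk A0) (wk A1) (ren (upr (upr Suc)) R) \<Longrightarrow>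
    \<Gamma> \<turnstile> Ungel Q \<doteq> Ungel Q' \<Colon> R[[Q[[Zero]], Q[[One]]]]"
| gel_beta: "\<Gamma> \<turnstile>\<^bsub>Large\<^esub> A0 \<Longrightarrow> \<Gamma> \<turnstile>\<^bsub>Large\<^esub> A1 \<Longrightarrow> Hyp (wk A1) # Hyp A0 # \<Gamma> \<turnstile>\<^bsub>Large\<^esub> R \<Longrightarrow>
    \<Gamma> \<turnstile> M0 \<Colon> A0 \<Longrightarrow> \<Gamma> \<turnstile> M1 \<Colon> A1 \<Longrightarrow> \<Gamma> \<turnstile> P \<Colon> R[[M0, M1]] \<Longrightarrow>
    \<Gamma> \<turnstile> Ungel (GelIn (Var 0) (wk M0) (wk M1) (wk P)) \<doteq> P \<Colon> R[[M0, M1]]"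
| gel_eta: "is_ctx \<Gamma> \<Longrightarrow> dim \<Gamma> BridgeI r \<Longrightarrow> \<Gamma> \<turnstile>\<^bsub>Large\<^esub> Gel r A0 A1 R \<Longrightarrow>
    Dim BridgeI # restrict \<Gamma> r \<turnstile> Q \<Colon> Gel (Var 0) (wk A0) (wk A1) (ren (upr (upr Suc)) R) \<Longrightarrow>
    \<Gamma> \<turnstile> Q[[r]] \<doteq> GelIn r (Q[[Zero]]) (Q[[One]]) (Ungel Q) \<Colon> Gel r A0 A1 R"

  \<comment> \<open>Kan operations at the individual type formers\<close>
| coe_pi: "\<Gamma> \<turnstile> Coe r s (Pi A B) M \<Colon> C \<Longrightarrow>
    \<Gamma> \<turnstile> Coe r s (Pi A B) M
       \<doteq> Lam (Coe (wk r) (wk s)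
               (sub (Coe (ren (\<lambda>n. n + 2) s) (Var 0) (ren (upr (\<lambda>n. n + 2)) A) (Var 1)
                     \<cdot> Var 0 \<cdot> (\<lambda>n. Var (n + 2))) B)
               (App (wk M) (Coe (wk s) (wk r) (ren (upr Suc) A) (Var 0)))) \<Colon> C"
| hcom_pi: "\<Gamma> \<turnstile> HCom r s (Pi A B) M ts \<Colon> C \<Longrightarrow>
    \<Gamma> \<turnstile> HCom r s (Pi A B) M ts
       \<doteq> Lam (HCom (wk r) (wk s) B (App (wk M) (Var 0))
               (map (tmap (\<lambda>N. App N (Var 1)) \<circ> ren_tube Suc) ts)) \<Colon> C"
| coe_sig: "\<Gamma> \<turnstile> Coe r s (Sig A B) M \<Colon> C \<Longrightarrow>
    \<Gamma> \<turnstile> Coe r s (Sig A B) M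
       \<doteq> Pr (Coe r s A (Fst M))
             (Coe r s (B[[Coe (wk r) (Var 0) (ren (upr Suc) A) (wk (Fst M))]]) (Snd M)) \<Colon> C"
| hcom_sig: "\<Gamma> \<turnstile> HCom r s (Sig A B) M ts \<Colon> C \<Longrightarrow>
    \<Gamma> \<turnstile> HCom r s (Sig A B) M ts
       \<doteq> Pr (HCom r s A (Fst M) (map (tmap Fst) ts))
             (Com r s
               (sub (HCom (wk r) (Var 0) (wk A) (wk (Fst M)) (map (tmap Fst \<circ> ren_tube Suc) ts)
                     \<cdot> (\<lambda>n. Var (n + 1))) B)
               (Snd M) (map (tmap Snd) ts)) \<Colon> C"
| coe_path: "\<Gamma> \<turnstile> Coe r s (PathT A P0 P1) M \<Colon> C \<Longrightarrow>
    \<Gamma> \<turnstile> Coe r s (PathT A P0 P1) M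
       \<doteq> PLam (Com (wk r) (wk s) (ren swap A) (PApp (wk M) (Var 0))
               [Tube PathI (Var 0) Zero (ren (upr Suc) P0),
                Tube PathI (Var 0) One (ren (upr Suc) P1)]) \<Colon> C"
| hcom_path: "\<Gamma> \<turnstile> HCom r s (PathT A P0 P1) M ts \<Colon> C \<Longrightarrow>
    \<Gamma> \<turnstile> HCom r s (PathT A P0 P1) M ts
       \<doteq> PLam (HCom (wk r) (wk s) A (PApp (wk M) (Var 0))
               (map (tmap (\<lambda>N. PApp N (Var 1)) \<circ> ren_tube Suc) ts @
                [Tube PathI (Var 0) Zero (ren (\<lambda>n. n + 2) P0),
                 Tube PathI (Var 0) One (ren (\<lambda>n. n + 2) P1)])) \<Colon> C"
| coe_bridge: "\<Gamma> \<turnstile> Coe r s (Bridge A P0 P1) M \<Colon> C \<Longrightarrow>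
    \<Gamma> \<turnstile> Coe r s (Bridge A P0 P1) M
       \<doteq> BLam (Com (wk r) (wk s) (ren swap A) (BApp (wk M) (Var 0))
               [Tube BridgeI (Var 0) Zero (ren (upr Suc) P0),
                Tube BridgeI (Var 0) One (ren (upr Suc) P1)]) \<Colon> C"
| hcom_bridge: "\<Gamma> \<turnstile> HCom r s (Bridge A P0 P1) M ts \<Colon> C \<Longrightarrow>
    \<Gamma> \<turnstile> HCom r s (Bridge A P0 P1) M ts
       \<doteq> BLam (HCom (wk r) (wk s) A (BApp (wk M) (Var 0))
               (map (tmap (\<lambda>N. BApp N (Var 1)) \<circ> ren_tube Suc) ts @
                [Tube BridgeI (Var 0) Zero (ren (\<lambda>n. n + 2) P0),
                 Tube BridgeI (Var 0) One (ren (\<lambda>n. n + 2) P1)])) \<Colon> C"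
| coe_bool: "\<Gamma> \<turnstile> Coe r s Bool M \<Colon> Bool \<Longrightarrow> \<Gamma> \<turnstile> M \<Colon> Bool \<Longrightarrow> \<Gamma> \<turnstile> Coe r s Bool M \<doteq> M \<Colon> Bool"
| coe_bot: "\<Gamma> \<turnstile> Coe r s Bot M \<Colon> Bot \<Longrightarrow> \<Gamma> \<turnstile> M \<Colon> Bot \<Longrightarrow> \<Gamma> \<turnstile> Coe r s Bot M \<doteq> M \<Colon> Bot"
| coe_univ: "\<Gamma> \<turnstile> Coe r s Univ M \<Colon> Univ \<Longrightarrow> \<Gamma> \<turnstile> M \<Colon> Univ \<Longrightarrow> \<Gamma> \<turnstile> Coe r s Univ M \<doteq> M \<Colon> Univ"
| coe_gel: "\<Gamma> \<turnstile> Coe r s (Gel (wk x) A0 A1 R) (M[[x]]) \<Colon> C \<Longrightarrow> dim \<Gamma> BridgeI x \<Longrightarrow>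
    Dim BridgeI # restrict \<Gamma> x
      \<turnstile> M \<Colon> Gel (Var 0) (wk (A0[[r]])) (wk (A1[[r]]))
              (ren (upr (upr Suc)) (sub (ups (ups (r \<cdot> Var))) R)) \<Longrightarrow>
    \<Gamma> \<turnstile> Coe r s (Gel (wk x) A0 A1 R) (M[[x]])
       \<doteq> GelIn x (Coe r s A0 (M[[Zero]])) (Coe r s A1 (M[[One]]))
           (Coe r s
             (R[[Coe (wk r) (Var 0) (ren (upr Suc) A0) (wk (M[[Zero]])),
                 Coe (wk r) (Var 0) (ren (upr Suc) A1) (wk (M[[One]]))]])
             (Ungel M)) \<Colon> C"
  \<comment> \<open>\<open>M\<close> and the tubes \<open>ts\<close> depend on a fresh bridge variable in place of \<open>x\<close>; in the
      witness of \<open>R\<close>, which does not depend on \<open>x\<close>, the tubes constraining \<open>x\<close> are dropped\<close>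
| hcom_gel: "\<Gamma> \<turnstile> HCom r s (Gel x A0 A1 R) (M[[x]]) (map (sub_tube (x \<cdot> Var)) ts) \<Colon> C \<Longrightarrow>
    dim \<Gamma> BridgeI x \<Longrightarrow>
    Dim BridgeI # restrict \<Gamma> x
      \<turnstile> HCom (wk r) (wk s) (Gel (Var 0) (wk A0) (wk A1) (ren (upr (upr Suc)) R)) M ts
        \<Colon> Gel (Var 0) (wk A0) (wk A1) (ren (upr (upr Suc)) R) \<Longrightarrow>
    \<Gamma> \<turnstile> HCom r s (Gel x A0 A1 R) (M[[x]]) (map (sub_tube (x \<cdot> Var)) ts)
       \<doteq> GelIn x
           (HCom r s A0 (M[[Zero]]) (map (sub_tube (Zero \<cdot> Var)) ts))
           (HCom r s A1 (M[[One]]) (map (sub_tube (One \<cdot> Var)) ts))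
           (Com r s
             (sub (HCom (wk r) (Var 0) (wk A1) (wk (M[[One]]))
                     (map (ren_tube Suc \<circ> sub_tube (One \<cdot> Var)) ts)
                   \<cdot> HCom (wk r) (Var 0) (wk A0) (wk (M[[Zero]]))
                       (map (ren_tube Suc \<circ> sub_tube (Zero \<cdot> Var)) ts)
                   \<cdot> (\<lambda>n. Var (n + 1))) R)
             (Ungel M)
             (map (\<lambda>t. case t of Tube k p q N \<Rightarrow>
                     Tube k (p[[Zero]]) (q[[Zero]]) (Ungel (ren swap N)))
                (filter apart0 ts))) \<Colon> C"

subsection \<open>The weak law of excluded middle\<close>

definition ifU :: "exp \<Rightarrow> exp \<Rightarrow> exp \<Rightarrow> exp" where "ifU b X Y = Cond Univ b X Y"

definition WLEM :: exp where
  "WLEM = Pi Univ (Sig Bool (ifU (Var 0) (neg (Var 1)) (neg (neg (Var 1)))))"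

end

theory Submission
  imports Defs
begin

text \<open>
  Let \<open>f : WLEM\<close>. Write \<open>G x = Gel x \<bottom> \<top> \<bottom>\<close>, a bridge of types from \<open>\<bottom>\<close> to \<open>\<top>\<close>, so that
  \<open>b x = fst (f (G x))\<close> is a bridge of booleans. Case analysis on \<open>b x\<close> into
  \<open>Gel x \<U> \<U> (X \<rightarrow> Y)\<close>, with the branches given by the implications \<open>\<not>\<bottom> \<rightarrow> \<top>\<close> and
  \<open>\<not>\<not>\<bottom> \<rightarrow> \<bottom>\<close>, produces after \<open>ungel\<close> a function
  \<open>(if b 0 then \<not>\<bottom> else \<not>\<not>\<bottom>) \<rightarrow> (if b 1 then \<top> else \<bottom>)\<close>. Its argument is supplied by
  \<open>snd (f \<bottom>)\<close>, and its result is refuted by \<open>snd (f \<top>) : if b 1 then \<not>\<top> else \<not>\<not>\<top>\<close>.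
\<close>

section \<open>Substitution, and typing rules for negation and boolean case analysis\<close>

lemmas sub_simps = scons_def ups_def upr_def

lemma sub_neg [simp]: "sub \<sigma> (neg A) = neg (sub \<sigma> A)"
  by (simp add: neg_def arrow_def)

lemma sub_ifU [simp]: "sub \<sigma> (ifU b A B) = ifU (sub \<sigma> b) (sub \<sigma> A) (sub \<sigma> B)"
  by (simp add: ifU_def)

lemma ren_neg [simp]: "ren \<rho> (neg A) = neg (ren \<rho> A)"
  by (simp add: neg_def arrow_def)

lemma ren_ifU [simp]: "ren \<rho> (ifU b A B) = ifU (ren \<rho> b) (ren \<rho> A) (ren \<rho> B)"
  by (simp add: ifU_def)

lemma wk_WLEM [simp]: "wk WLEM = WLEM"
  by (simp add: WLEM_def upr_def)

lemma ctx_small: "is_ctx \<Gamma> \<Longrightarrow> \<Gamma> \<turnstile>\<^bsub>Small\<^esub> A \<Longrightarrow> is_ctx (Hyp A # \<Gamma>)"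
  by (intro ctx_hyp ty_lift)

lemma univ_var: "is_ctx \<Gamma> \<Longrightarrow> lookup \<Gamma> n = Hyp Univ \<Longrightarrow> \<Gamma> \<turnstile>\<^bsub>Small\<^esub> Var n"
  by (intro univ_E tm_var)

lemma neg_F: "is_ctx \<Gamma> \<Longrightarrow> \<Gamma> \<turnstile>\<^bsub>Small\<^esub> A \<Longrightarrow> \<Gamma> \<turnstile>\<^bsub>Small\<^esub> neg A"
  unfolding neg_def arrow_def by (auto intro: pi_F bot_F ctx_small)

lemma neg_I: "\<Gamma> \<turnstile>\<^bsub>Small\<^esub> A \<Longrightarrow> Hyp A # \<Gamma> \<turnstile> M \<Colon> Bot \<Longrightarrow> \<Gamma> \<turnstile> Lam M \<Colon> neg A"
  unfolding neg_def arrow_def by (auto intro: pi_I ty_lift)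

lemma neg_E: "\<Gamma> \<turnstile> M \<Colon> neg A \<Longrightarrow> \<Gamma> \<turnstile> N \<Colon> A \<Longrightarrow> \<Gamma> \<turnstile> App M N \<Colon> Bot"
  unfolding neg_def arrow_def using pi_E[of \<Gamma> M M A "wk Bot" N N] by simp

text \<open>A case analysis into types is a term with constant motive \<open>Univ\<close>, read back
  as a small type by \<open>univ_E\<close>.\<close>

lemma ifU_F:
  assumes "is_ctx \<Gamma>" "\<Gamma> \<turnstile> b \<doteq> b' \<Colon> Bool" "\<Gamma> \<turnstile>\<^bsub>Small\<^esub> A \<doteq> A'" "\<Gamma> \<turnstile>\<^bsub>Small\<^esub> B \<doteq> B'"
  shows "\<Gamma> \<turnstile>\<^bsub>Small\<^esub> ifU b A B \<doteq> ifU b' A' B'"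
proof -
  have "Hyp Bool # \<Gamma> \<turnstile>\<^bsub>Large\<^esub> Univ"
    using assms(1) by (intro univ_F ctx_small bool_F)
  from bool_E[OF this assms(2), of A A' B B']
  have "\<Gamma> \<turnstile> Cond Univ b A B \<doteq> Cond Univ b' A' B' \<Colon> Univ"
    using univ_I[OF assms(3)] univ_I[OF assms(4)] by simp
  then show ?thesis
    unfolding ifU_def by (rule univ_E)
qed

lemma ifU_beta:
  assumes "is_ctx \<Gamma>" "\<Gamma> \<turnstile>\<^bsub>Small\<^esub> A" "\<Gamma> \<turnstile>\<^bsub>Small\<^esub> B"
  shows "\<Gamma> \<turnstile>\<^bsub>Large\<^esub> ifU TT A B \<doteq> A" and "\<Gamma> \<turnstile>\<^bsub>Large\<^esub> ifU FF A B \<doteq> B"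
proof -
  have U: "Hyp Bool # \<Gamma> \<turnstile>\<^bsub>Large\<^esub> Univ"
    using assms(1) by (intro univ_F ctx_small bool_F)
  have "\<Gamma> \<turnstile> ifU TT A B \<doteq> A \<Colon> Univ" "\<Gamma> \<turnstile> ifU FF A B \<doteq> B \<Colon> Univ"
    using bool_beta1[OF U, of A B] bool_beta2[OF U, of A B] univ_I[OF assms(2)] univ_I[OF assms(3)]
    by (simp_all add: ifU_def)
  then show "\<Gamma> \<turnstile>\<^bsub>Large\<^esub> ifU TT A B \<doteq> A" "\<Gamma> \<turnstile>\<^bsub>Large\<^esub> ifU FF A B \<doteq> B"
    by (auto intro: ty_lift dest: univ_E)
qed

subsection \<open>Eliminating a proof of WLEM\<close>

lemma WLEM_F:
  assumes "is_ctx \<Gamma>"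
  shows "\<Gamma> \<turnstile>\<^bsub>Large\<^esub> WLEM"
proof -
  have U: "is_ctx (Hyp Univ # \<Gamma>)"
    using assms by (intro ctx_hyp univ_F)
  have B: "is_ctx (Hyp Bool # Hyp Univ # \<Gamma>)"
    using ctx_small[OF U bool_F[OF U]] .
  have "Hyp Bool # Hyp Univ # \<Gamma> \<turnstile>\<^bsub>Small\<^esub> ifU (Var 0) (neg (Var 1)) (neg (neg (Var 1)))"
    using B by (intro ifU_F neg_F univ_var tm_var) auto
  then show ?thesis
    unfolding WLEM_def using assms U by (intro pi_F sig_F univ_F ty_lift bool_F) auto
qed

lemma ctx_WLEM: "is_ctx \<Gamma> \<Longrightarrow> is_ctx (Hyp WLEM # \<Gamma>)"
  by (intro ctx_hyp WLEM_F)

text \<open>Congruence in the type argument later replaces \<open>bot_top_gel Zero\<close> by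
  \<open>Bot\<close> and \<open>bot_top_gel One\<close> by \<open>Top\<close> inside the
  boolean.\<close>

lemma WLEM_fst:
  assumes "\<Gamma> \<turnstile> F \<Colon> WLEM" "\<Gamma> \<turnstile>\<^bsub>Small\<^esub> A \<doteq> A'"
  shows "\<Gamma> \<turnstile> Fst (App F A) \<doteq> Fst (App F A') \<Colon> Bool"
proof -
  have "\<Gamma> \<turnstile> App F A \<doteq> App F A'
      \<Colon> (Sig Bool (ifU (Var 0) (neg (Var 1)) (neg (neg (Var 1)))))[[A]]"
    using pi_E[OF assms(1)[unfolded WLEM_def] univ_I[OF assms(2)]] .
  then show ?thesis
    by (auto intro: sig_E1)
qed

text \<open>The argument is carried under a binder and then instantiated again; closedness lets both
  operations leave \<open>A\<close> alone. The instances used are \<open>Bot\<close> and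
  \<open>Top\<close>.\<close>

lemma WLEM_snd:
  assumes "\<Gamma> \<turnstile> F \<Colon> WLEM" "\<Gamma> \<turnstile>\<^bsub>Small\<^esub> A" and closed: "\<And>\<sigma>. sub \<sigma> A = A" "wk A = A"
  shows "\<Gamma> \<turnstile> Snd (App F A) \<Colon> ifU (Fst (App F A)) (neg A) (neg (neg A))"
proof -
  have "\<Gamma> \<turnstile> App F A
      \<Colon> (Sig Bool (ifU (Var 0) (neg (Var 1)) (neg (neg (Var 1)))))[[A]]"
    using pi_E[OF assms(1)[unfolded WLEM_def] univ_I[OF assms(2)]] .
  then have "\<Gamma> \<turnstile> App F A \<Colon> Sig Bool (ifU (Var 0) (neg A) (neg (neg A)))"
    by (simp add: sub_simps closed)
  from sig_E2[OF this] show ?thesis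
    by (simp add: sub_simps closed)
qed

subsection \<open>The bridges of types and of booleans\<close>

definition bot_top_gel :: "exp \<Rightarrow> exp" where
  "bot_top_gel r = Gel r Bot Top Bot"

text \<open>The components of a Gel-type live in the context restricted by \<open>r\<close>, so its
  well-formedness is a separate hypothesis. It is immediate at the endpoints, where restriction does
  nothing, and at the bridge variables below, where deletions leave \<open>Removed\<close>
  entries.\<close>

lemma bot_top_gel_F:
  assumes "is_ctx \<Gamma>" "dim \<Gamma> BridgeI r" "is_ctx (restrict \<Gamma> r)"
  shows "\<Gamma> \<turnstile>\<^bsub>Small\<^esub> bot_top_gel r"
proof -
  have 1: "is_ctx (Hyp Bot # restrict \<Gamma> r)"
    using assms(3) by (intro ctx_small bot_F)
  have "is_ctx (Hyp (wk Top) # Hyp Bot # restrict \<Gamma> r)"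
    using ctx_small[OF 1 top_F[OF 1]] by simp
  then show ?thesis
    unfolding bot_top_gel_def using assms by (intro gel_F bot_F top_F)
qed

lemma bot_top_gel_0: "is_ctx \<Gamma> \<Longrightarrow> \<Gamma> \<turnstile>\<^bsub>Small\<^esub> bot_top_gel Zero \<doteq> Bot"
  using bot_top_gel_F[of \<Gamma> Zero] unfolding bot_top_gel_def
  by (intro gel_F0 bot_F) (auto intro: dim_eq.intros(1) dim.intros)

lemma bot_top_gel_1: "is_ctx \<Gamma> \<Longrightarrow> \<Gamma> \<turnstile>\<^bsub>Small\<^esub> bot_top_gel One \<doteq> Top"
  using bot_top_gel_F[of \<Gamma> One] unfolding bot_top_gel_def
  by (intro gel_F1 top_F) (auto intro: dim_eq.intros(1) dim.intros)

lemma sub_bot_top_gel [simp]: "sub \<sigma> (bot_top_gel r) = bot_top_gel (sub \<sigma> r)"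
  by (simp add: bot_top_gel_def)

lemma ren_bot_top_gel [simp]: "ren \<rho> (bot_top_gel r) = bot_top_gel (ren \<rho> r)"
  by (simp add: bot_top_gel_def)

text \<open>The witnesses of the relation are functions from the left type, \<open>Var 1\<close>, to
  the right type, \<open>Var 0\<close>. An element over a bridge variable is thus a bridge of small
  types carrying a function between its ends.\<close>

definition fun_gel :: "exp \<Rightarrow> exp" where
  "fun_gel r = Gel r Univ Univ (arrow (Var 1) (Var 0))"

lemma sub_fun_gel [simp]: "sub \<sigma> (fun_gel r) = fun_gel (sub \<sigma> r)"
  by (simp add: fun_gel_def arrow_def sub_simps)

lemma ren_fun_gel [simp]: "ren \<rho> (fun_gel r) = fun_gel (ren \<rho> r)"
  by (simp add: fun_gel_def arrow_def sub_simps)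

lemma arrow_univ_F:
  assumes "is_ctx \<Gamma>"
  shows "Hyp Univ # Hyp Univ # \<Gamma> \<turnstile>\<^bsub>Large\<^esub> arrow (Var 1) (Var 0)"
proof -
  have U: "is_ctx (Hyp Univ # Hyp Univ # \<Gamma>)"
    using assms by (intro ctx_hyp univ_F)
  have "is_ctx (Hyp (Var 1) # Hyp Univ # Hyp Univ # \<Gamma>)"
    by (rule ctx_small[OF U univ_var[OF U]]) simp
  then show ?thesis
    unfolding arrow_def using U by (intro ty_lift pi_F univ_var) (auto intro: univ_var)
qed

lemma fun_gel_F:
  assumes "is_ctx \<Gamma>" "dim \<Gamma> BridgeI r" "is_ctx (restrict \<Gamma> r)"
  shows "\<Gamma> \<turnstile>\<^bsub>Large\<^esub> fun_gel r"
  unfolding fun_gel_def using assms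
  by (intro gel_F univ_F) (auto intro: arrow_univ_F[unfolded One_nat_def])

lemma fun_gel_0: "is_ctx \<Gamma> \<Longrightarrow> \<Gamma> \<turnstile>\<^bsub>Large\<^esub> fun_gel Zero \<doteq> Univ"
  using fun_gel_F[of \<Gamma> Zero] unfolding fun_gel_def
  by (intro gel_F0 univ_F) (auto intro: dim_eq.intros(1) dim.intros)

lemma fun_gel_1: "is_ctx \<Gamma> \<Longrightarrow> \<Gamma> \<turnstile>\<^bsub>Large\<^esub> fun_gel One \<doteq> Univ"
  using fun_gel_F[of \<Gamma> One] unfolding fun_gel_def
  by (intro gel_F1 univ_F) (auto intro: dim_eq.intros(1) dim.intros)

text \<open>\<open>arrow\<close> weakens its codomain, so the witness must lie in
  \<open>Pi A (wk B)\<close>; \<open>wk B = B\<close> makes this the type of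
  \<open>Lam P\<close>.\<close>

lemma fun_gel_I:
  assumes "is_ctx \<Gamma>" "dim \<Gamma> BridgeI r" "is_ctx (restrict \<Gamma> r)"
    and "restrict \<Gamma> r \<turnstile>\<^bsub>Small\<^esub> A" "restrict \<Gamma> r \<turnstile>\<^bsub>Small\<^esub> B"
    and "Hyp A # restrict \<Gamma> r \<turnstile> P \<Colon> B" and closed: "wk B = B"
  shows "\<Gamma> \<turnstile> GelIn r A B (Lam P) \<Colon> fun_gel r"
proof -
  have "restrict \<Gamma> r \<turnstile> Lam P \<Colon> Pi A B"
    using assms by (intro pi_I ty_lift)
  then have "restrict \<Gamma> r \<turnstile> Lam P \<Colon> (arrow (Var 1) (Var 0))[[A, B]]"
    by (simp add: arrow_def sub_simps closed)
  then show ?thesis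
    unfolding fun_gel_def using assms fun_gel_F[of \<Gamma> r]
    by (intro gel_I univ_I) (auto simp: fun_gel_def)
qed

definition implies_top :: "exp \<Rightarrow> exp" where
  "implies_top r = GelIn r (neg Bot) Top (Lam Star)"

text \<open>A proof of \<open>neg (neg Bot)\<close> yields \<open>Bot\<close> when applied to the
  identity function, which proves \<open>neg Bot\<close>.\<close>

definition implies_bot :: "exp \<Rightarrow> exp" where
  "implies_bot r = GelIn r (neg (neg Bot)) Bot (Lam (App (Var 0) (Lam (Var 0))))"

lemma implies_top_I:
  assumes "is_ctx \<Gamma>" "dim \<Gamma> BridgeI r" "is_ctx (restrict \<Gamma> r)"
  shows "\<Gamma> \<turnstile> implies_top r \<Colon> fun_gel r"
  unfolding implies_top_def using assms
  by (intro fun_gel_I neg_F bot_F top_F top_I ctx_small) auto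

lemma implies_bot_I:
  assumes "is_ctx \<Gamma>" "dim \<Gamma> BridgeI r" "is_ctx (restrict \<Gamma> r)"
  shows "\<Gamma> \<turnstile> implies_bot r \<Colon> fun_gel r"
proof -
  let ?\<Delta> = "Hyp (neg (neg Bot)) # restrict \<Gamma> r"
  have \<Delta>: "is_ctx ?\<Delta>"
    using assms(3) by (intro ctx_small neg_F bot_F)
  have "Hyp Bot # ?\<Delta> \<turnstile> Var 0 \<Colon> Bot"
    using ctx_small[OF \<Delta> bot_F[OF \<Delta>]] by (rule tm_var) simp
  then have "?\<Delta> \<turnstile> Lam (Var 0) \<Colon> neg Bot"
    by (rule neg_I[OF bot_F[OF \<Delta>]])
  moreover have "?\<Delta> \<turnstile> Var 0 \<Colon> neg (neg Bot)"
    using \<Delta> by (rule tm_var) simp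
  ultimately have "?\<Delta> \<turnstile> App (Var 0) (Lam (Var 0)) \<Colon> Bot"
    by (rule neg_E[rotated])
  then show ?thesis
    unfolding implies_bot_def using assms by (intro fun_gel_I neg_F bot_F) auto
qed

section \<open>The bridge of types defined by cases on the bridge of booleans\<close>

definition type_bridge :: "exp \<Rightarrow> exp \<Rightarrow> exp" where
  "type_bridge F r =
     Cond (fun_gel (wk r)) (Fst (App F (bot_top_gel r))) (implies_top r) (implies_bot r)"

text \<open>The side condition, needed for the motive, holds by computation when \<open>r\<close> is
  a variable or an endpoint.\<close>

lemma sub_type_bridge [simp]:
  assumes "sub (ups \<sigma>) (wk r) = wk (sub \<sigma> r)"
  shows "sub \<sigma> (type_bridge F r) = type_bridge (sub \<sigma> F) (sub \<sigma> r)"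
  using assms
  by (simp add: type_bridge_def implies_top_def implies_bot_def sub_simps)

text \<open>The boolean is eliminated while the bridge variable is still in scope, with a motive
  constant in the boolean. This avoids showing that the booleans at the two ends agree.\<close>

lemma type_bridge_I:
  assumes "is_ctx \<Gamma>"
  shows "Dim BridgeI # Hyp WLEM # \<Gamma> \<turnstile> type_bridge (Var 1) (Var 0) \<Colon> fun_gel (Var 0)"
proof -
  let ?\<Delta> = "Dim BridgeI # Hyp WLEM # \<Gamma>"
  have ctx: "is_ctx (Hyp WLEM # \<Gamma>)" "is_ctx ?\<Delta>" "is_ctx (restrict ?\<Delta> (Var 0))"
    using ctx_WLEM[OF assms] by (auto intro: ctx_dim ctx_removed)
  have dim: "dim ?\<Delta> BridgeI (Var 0)"
    by (auto intro: dim.intros)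
  have "is_ctx (Hyp Bool # ?\<Delta>)"
    using ctx by (intro ctx_small bool_F)
  \<comment> \<open>Under the boolean hypothesis the bridge variable has index 1.\<close>
  then have "Hyp Bool # ?\<Delta> \<turnstile>\<^bsub>Large\<^esub> fun_gel (Var 1)"
    using ctx by (intro fun_gel_F) (auto intro: dim.intros ctx_removed)
  moreover have "?\<Delta> \<turnstile> Fst (App (Var 1) (bot_top_gel (Var 0))) \<Colon> Bool"
    using ctx dim by (intro WLEM_fst bot_top_gel_F tm_var) auto
  moreover have "?\<Delta> \<turnstile> implies_top (Var 0) \<Colon> (fun_gel (Var 1))[[TT]]"
    using implies_top_I[OF ctx(2) dim ctx(3)] by (simp add: sub_simps)
  moreover have "?\<Delta> \<turnstile> implies_bot (Var 0) \<Colon> (fun_gel (Var 1))[[FF]]"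
    using implies_bot_I[OF ctx(2) dim ctx(3)] by (simp add: sub_simps)
  ultimately have "?\<Delta> \<turnstile> Cond (fun_gel (Var 1)) (Fst (App (Var 1) (bot_top_gel (Var 0))))
        (implies_top (Var 0)) (implies_bot (Var 0))
      \<Colon> (fun_gel (Var 1))[[Fst (App (Var 1) (bot_top_gel (Var 0)))]]"
    by (rule bool_E)
  then show ?thesis
    by (simp add: type_bridge_def sub_simps)
qed

text \<open>The congruence rule of \<open>Cond\<close> changes motive, scrutinee and branches at
  once, so no case distinction on the boolean arises.\<close>

lemma type_bridge_endpoint:
  assumes ctx: "is_ctx \<Gamma>" and F: "\<Gamma> \<turnstile> F \<Colon> WLEM" and r: "r \<in> {Zero, One}"
    and gel: "\<Gamma> \<turnstile>\<^bsub>Large\<^esub> fun_gel r \<doteq> Univ" "\<Gamma> \<turnstile>\<^bsub>Small\<^esub> bot_top_gel r \<doteq> A"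
    and top: "\<Gamma> \<turnstile> implies_top r \<doteq> T \<Colon> Univ"
    and bot: "\<Gamma> \<turnstile> implies_bot r \<doteq> B \<Colon> Univ"
  shows "\<Gamma> \<turnstile>\<^bsub>Large\<^esub> type_bridge F r \<doteq> ifU (Fst (App F A)) T B"
proof -
  have B: "is_ctx (Hyp Bool # \<Gamma>)"
    using ctx by (intro ctx_small bool_F)
  have wk: "wk r = r" "\<And>\<sigma>. sub \<sigma> r = r"
    using r by auto
  have C: "Hyp Bool # \<Gamma> \<turnstile>\<^bsub>Large\<^esub> fun_gel r \<doteq> Univ"
    using r fun_gel_0[OF B] fun_gel_1[OF B] by auto
  have "\<Gamma> \<turnstile> Cond (fun_gel r) (Fst (App F (bot_top_gel r))) (implies_top r) (implies_bot r)
      \<doteq> Cond Univ (Fst (App F A)) T B \<Colon> (fun_gel r)[[Fst (App F (bot_top_gel r))]]"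
    \<comment> \<open>The rule types the branches in the left-hand motive, so their equations are
      first converted from \<open>Univ\<close> to \<open>fun_gel r\<close>.\<close>
    by (rule bool_E[OF C WLEM_fst[OF F gel(2)]])
      (use tm_conv[OF top ty_sym[OF gel(1)]] tm_conv[OF bot ty_sym[OF gel(1)]] in \<open>simp_all add: wk\<close>)
  then have "\<Gamma> \<turnstile> type_bridge F r \<doteq> ifU (Fst (App F A)) T B \<Colon> fun_gel r"
    by (simp add: type_bridge_def ifU_def wk)
  then show ?thesis
    using gel(1) by (rule ty_lift[OF univ_E[OF tm_conv]])
qed

text \<open>At 0 the \<open>GelIn\<close> branches reduce to their first components, which gives
  exactly the type of \<open>Snd (App F Bot)\<close>.\<close>

lemma type_bridge_0:
  assumes "is_ctx \<Gamma>" "\<Gamma> \<turnstile> F \<Colon> WLEM"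
  shows "\<Gamma> \<turnstile>\<^bsub>Large\<^esub> type_bridge F Zero \<doteq> ifU (Fst (App F Bot)) (neg Bot) (neg (neg Bot))"
proof (rule type_bridge_endpoint[OF assms _ fun_gel_0 bot_top_gel_0])
  have d: "dim \<Gamma> BridgeI Zero" "dim_eq \<Gamma> BridgeI Zero Zero"
    by (auto intro: dim_eq.intros(1) dim.intros)
  show "\<Gamma> \<turnstile> implies_top Zero \<doteq> neg Bot \<Colon> Univ"
    using implies_top_I[of \<Gamma> Zero] assms d unfolding implies_top_def fun_gel_def
    by (intro gel_I0 univ_I neg_F bot_F) auto
  show "\<Gamma> \<turnstile> implies_bot Zero \<doteq> neg (neg Bot) \<Colon> Univ"
    using implies_bot_I[of \<Gamma> Zero] assms d unfolding implies_bot_def fun_gel_def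
    by (intro gel_I0 univ_I neg_F bot_F) auto
qed (use assms in auto)

text \<open>At 1 the branches reduce to their second components, and the boolean becomes the
  decision made for \<open>Top\<close>.\<close>

lemma type_bridge_1:
  assumes "is_ctx \<Gamma>" "\<Gamma> \<turnstile> F \<Colon> WLEM"
  shows "\<Gamma> \<turnstile>\<^bsub>Large\<^esub> type_bridge F One \<doteq> ifU (Fst (App F Top)) Top Bot"
proof (rule type_bridge_endpoint[OF assms _ fun_gel_1 bot_top_gel_1])
  have d: "dim \<Gamma> BridgeI One" "dim_eq \<Gamma> BridgeI One One"
    by (auto intro: dim_eq.intros(1) dim.intros)
  show "\<Gamma> \<turnstile> implies_top One \<doteq> Top \<Colon> Univ"
    using implies_top_I[of \<Gamma> One] assms d unfolding implies_top_def fun_gel_def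
    by (intro gel_I1 univ_I top_F) auto
  show "\<Gamma> \<turnstile> implies_bot One \<doteq> Bot \<Colon> Univ"
    using implies_bot_I[of \<Gamma> One] assms d unfolding implies_bot_def fun_gel_def
    by (intro gel_I1 univ_I bot_F) auto
qed (use assms in auto)

text \<open>\<open>Ungel\<close> extracts the function from end 0 to end 1 of the bridge of types;
  the evidence produced for \<open>Bot\<close> is a legitimate argument.\<close>

lemma bridge_transport:
  assumes "is_ctx \<Gamma>"
  shows "Hyp WLEM # \<Gamma> \<turnstile> App (Ungel (type_bridge (Var 1) (Var 0))) (Snd (App (Var 0) Bot))
    \<Colon> ifU (Fst (App (Var 0) Top)) Top Bot"
proof -
  let ?\<Delta> = "Hyp WLEM # \<Gamma>" and ?Q = "type_bridge (Var 1) (Var 0)"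
  have ctx: "is_ctx ?\<Delta>"
    using assms by (rule ctx_WLEM)
  have F: "?\<Delta> \<turnstile> Var 0 \<Colon> WLEM"
    using ctx by (intro tm_var) auto
  have "Hyp (wk Univ) # Hyp Univ # ?\<Delta> \<turnstile>\<^bsub>Large\<^esub> arrow (Var 1) (Var 0)"
    using arrow_univ_F[OF ctx] by simp
  moreover have "Dim BridgeI # ?\<Delta> \<turnstile> ?Q
      \<Colon> Gel (Var 0) (wk Univ) (wk Univ) (ren (upr (upr Suc)) (arrow (Var 1) (Var 0)))"
    using type_bridge_I[OF assms] by (simp add: fun_gel_def arrow_def sub_simps)
  ultimately have "?\<Delta> \<turnstile> Ungel ?Q \<Colon> (arrow (Var 1) (Var 0))[[?Q[[Zero]], ?Q[[One]]]]"
    by (rule gel_E[OF univ_F[OF ctx] univ_F[OF ctx]])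
  then have U: "?\<Delta> \<turnstile> Ungel ?Q
      \<Colon> Pi (type_bridge (Var 0) Zero) (wk (type_bridge (Var 0) One))"
    by (simp add: arrow_def sub_simps)
  have "?\<Delta> \<turnstile> Snd (App (Var 0) Bot) \<Colon> type_bridge (Var 0) Zero"
    using ctx F by (intro tm_conv[OF WLEM_snd ty_sym[OF type_bridge_0]] bot_F) auto
  \<comment> \<open>The codomain is weakened, so instantiating it with the argument gives back the
    type at end 1.\<close>
  from pi_E[OF U this]
  have "?\<Delta> \<turnstile> App (Ungel ?Q) (Snd (App (Var 0) Bot)) \<Colon> type_bridge (Var 0) One"
    by (simp add: type_bridge_def implies_top_def implies_bot_def sub_simps)
  then show ?thesis
    using type_bridge_1[OF ctx F] by (rule tm_conv)
qed

section \<open>Contradiction at the unit type\<close>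

definition clash_type :: "exp \<Rightarrow> exp" where
  "clash_type b = Pi (ifU b (neg Top) (neg (neg Top))) (neg (ifU (wk b) Top Bot))"

lemma inst_clash_type [simp]: "(clash_type (Var 0))[[b]] = clash_type b"
  by (simp add: clash_type_def sub_simps)

lemma ctx_clash:
  assumes "is_ctx \<Gamma>" "\<Gamma> \<turnstile> b \<Colon> Bool"
  shows "is_ctx (Hyp (ifU b (neg Top) (neg (neg Top))) # \<Gamma>)"
  using assms by (intro ctx_small ifU_F neg_F top_F)

text \<open>The typing of \<open>wk b\<close> is taken as a hypothesis; for the variable in the
  motive of \<open>clash\<close> it is an instance of the variable rule.\<close>

lemma clash_type_F:
  assumes "is_ctx \<Gamma>" "\<Gamma> \<turnstile> b \<Colon> Bool"
    and "Hyp (ifU b (neg Top) (neg (neg Top))) # \<Gamma> \<turnstile> wk b \<Colon> Bool"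
  shows "\<Gamma> \<turnstile>\<^bsub>Large\<^esub> clash_type b"
  unfolding clash_type_def using assms ctx_clash[OF assms(1,2)]
  by (intro ty_lift pi_F ifU_F neg_F top_F bot_F)

lemma clash_I:
  assumes ctx: "is_ctx \<Gamma>" and b: "b \<in> {TT, FF}"
    and M: "is_ctx (Hyp (ifU b Top Bot) # Hyp (ifU b (neg Top) (neg (neg Top))) # \<Gamma>) \<Longrightarrow>
      Hyp (ifU b Top Bot) # Hyp (ifU b (neg Top) (neg (neg Top))) # \<Gamma> \<turnstile> M \<Colon> Bot"
  shows "\<Gamma> \<turnstile> Lam (Lam M) \<Colon> clash_type b"
proof -
  have bool: "\<Delta> \<turnstile> b \<Colon> Bool" if "is_ctx \<Delta>" for \<Delta>
    using b that by (auto intro: bool_I1 bool_I2)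
  let ?\<Delta> = "Hyp (ifU b (neg Top) (neg (neg Top))) # \<Gamma>"
  have \<Delta>: "is_ctx ?\<Delta>"
    using ctx bool by (intro ctx_clash)
  then have B: "?\<Delta> \<turnstile>\<^bsub>Small\<^esub> ifU b Top Bot"
    using bool by (intro ifU_F top_F bot_F)
  have "?\<Delta> \<turnstile> Lam M \<Colon> neg (ifU b Top Bot)"
    using neg_I[OF B M[OF ctx_small[OF \<Delta> B]]] .
  moreover have "wk b = b"
    using b by auto
  moreover have "\<Gamma> \<turnstile>\<^bsub>Large\<^esub> ifU b (neg Top) (neg (neg Top))"
    using ctx bool by (intro ty_lift ifU_F neg_F top_F)
  ultimately show ?thesis
    unfolding clash_type_def by (auto intro: pi_I)
qed

text \<open>Both types in \<open>clash_type b\<close> compute once \<open>b\<close> is a constant: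
  for \<open>TT\<close> a refutation of \<open>Top\<close> meets an element of \<open>Top\<close>,
  for \<open>FF\<close> the second argument already lies in \<open>Bot\<close>.\<close>

definition clash :: "exp \<Rightarrow> exp" where
  "clash b = Cond (clash_type (Var 0)) b (Lam (Lam (App (Var 1) (Var 0)))) (Lam (Lam (Var 0)))"

lemma clash_tm:
  assumes ctx: "is_ctx \<Gamma>" and b: "\<Gamma> \<turnstile> b \<Colon> Bool"
  shows "\<Gamma> \<turnstile> clash b \<Colon> clash_type b"
proof -
  have B: "is_ctx (Hyp Bool # \<Gamma>)"
    using ctx by (intro ctx_small bool_F)
  have v: "Hyp Bool # \<Gamma> \<turnstile> Var 0 \<Colon> Bool"
    using B by (intro tm_var) auto
  have C: "Hyp Bool # \<Gamma> \<turnstile>\<^bsub>Large\<^esub> clash_type (Var 0)"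
    using ctx_clash[OF B v] by (intro clash_type_F B v) (auto intro!: tm_var)
  have "\<Gamma> \<turnstile> Lam (Lam (App (Var 1) (Var 0))) \<Colon> clash_type TT"
  proof (rule clash_I[OF ctx])
    let ?\<Delta> = "Hyp (ifU TT Top Bot) # Hyp (ifU TT (neg Top) (neg (neg Top))) # \<Gamma>"
    assume \<Delta>: "is_ctx ?\<Delta>"
    have "?\<Delta> \<turnstile> Var 1 \<Colon> ifU TT (neg Top) (neg (neg Top))"
      using \<Delta> by (intro tm_var) auto
    then have "?\<Delta> \<turnstile> Var 1 \<Colon> neg Top"
      by (rule tm_conv) (intro ifU_beta neg_F top_F \<Delta>)
    moreover have "?\<Delta> \<turnstile> Var 0 \<Colon> ifU TT Top Bot"
      using \<Delta> by (intro tm_var) auto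
    then have "?\<Delta> \<turnstile> Var 0 \<Colon> Top"
      by (rule tm_conv) (intro ifU_beta top_F bot_F \<Delta>)
    ultimately show "?\<Delta> \<turnstile> App (Var 1) (Var 0) \<Colon> Bot"
      by (rule neg_E)
  qed simp
  moreover have "\<Gamma> \<turnstile> Lam (Lam (Var 0)) \<Colon> clash_type FF"
  proof (rule clash_I[OF ctx])
    let ?\<Delta> = "Hyp (ifU FF Top Bot) # Hyp (ifU FF (neg Top) (neg (neg Top))) # \<Gamma>"
    assume \<Delta>: "is_ctx ?\<Delta>"
    then have "?\<Delta> \<turnstile> Var 0 \<Colon> ifU FF Top Bot"
      by (intro tm_var) auto
    then show "?\<Delta> \<turnstile> Var 0 \<Colon> Bot"
      by (rule tm_conv) (intro ifU_beta top_F bot_F \<Delta>)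
  qed simp
  ultimately show ?thesis
    using bool_E[OF C b] by (simp add: clash_def)
qed

theorem theorem3p19:
  shows "\<exists>M. [] \<turnstile> M \<Colon> neg WLEM"
proof
  let ?b = "Fst (App (Var 0) Top)"
  let ?N = "App (Ungel (type_bridge (Var 1) (Var 0))) (Snd (App (Var 0) Bot))"
  let ?\<Gamma> = "[Hyp WLEM]"
  have ctx: "is_ctx ?\<Gamma>"
    by (intro ctx_WLEM ctx_nil)
  have F: "?\<Gamma> \<turnstile> Var 0 \<Colon> WLEM"
    using ctx by (intro tm_var) auto
  have "?\<Gamma> \<turnstile> clash ?b \<Colon> clash_type ?b"
    using ctx F by (intro clash_tm WLEM_fst top_F)
  moreover have "?\<Gamma> \<turnstile> Snd (App (Var 0) Top) \<Colon> ifU ?b (neg Top) (neg (neg Top))"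
    using ctx F by (intro WLEM_snd top_F) auto
  ultimately have "?\<Gamma> \<turnstile> App (clash ?b) (Snd (App (Var 0) Top)) \<Colon> neg (ifU ?b Top Bot)"
    unfolding clash_type_def by (auto dest: pi_E simp: sub_simps)
  \<comment> \<open>The transported term \<open>?N\<close> inhabits the type just refuted, because
    both sides mention the same boolean \<open>?b\<close>.\<close>
  then have "?\<Gamma> \<turnstile> App (App (clash ?b) (Snd (App (Var 0) Top))) ?N \<Colon> Bot"
    using bridge_transport[OF ctx_nil] by (rule neg_E)
  then show "[] \<turnstile> Lam (App (App (clash ?b) (Snd (App (Var 0) Top))) ?N) \<Colon> neg WLEM"
    unfolding neg_def arrow_def using WLEM_F[OF ctx_nil] by (auto intro: pi_I)
qed

end
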